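(* Let $\phi$ be an analytic self-map of the upper half-plane $\mathbb{H}$ of parabolic type, i.e. such that $$\phi(z)\longrightarrow\infty\qquad\text{and}\qquad\frac{\phi(z)}{z}\longrightarrow 1$$ as $z\to\infty$ non-tangentially. Let $\{w_n=x_n+iy_n\}_{n=0}^{\infty}\subset\mathbb{H}$ (with $x_n,y_n$ real) be a backward-iteration sequence for $\phi$, i.e. $\phi(w_{n+1})=w_n$ for $n=0,1,2,\dots$, with bounded pseudo-hyperbolic steps $d_n=d(w_n,w_{n+1})\uparrow a<1$, which tends to infinity. Assume also that $\operatorname{Arg} w_n$ tends to $0$. Consider the automorphisms of $\mathbb{H}$ given by $\tau_n(z)=x_n+y_nz$. Then the normalized iterates $\phi_n\circ\tau_n$ converge uniformly on compact subsets of $\mathbb{H}$ to an analytic self-map $\psi$ of $\mathbb{H}$ such that $$\psi(z-b_0)=\phi\circ\psi(z)\qquad (z\in\mathbb{H}),$$ where $$b_0=\frac{2a}{\sqrt{1-a^2}}=\lim_{n\to\infty}\frac{x_{n+1}-x_n}{y_n}.$$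
   Context: $\mathbb{H}=\{z\in\mathbb{C}:\operatorname{Im} z>0\}$, and $d(z,w)=\left|\frac{w-z}{w-\overline{z}}\right|$ is the pseudo-hyperbolic distance on $\mathbb{H}$. "$z\to\infty$ non-tangentially" means that $z\to\infty$ within a sector $\{|\operatorname{Arg} z-\pi/2|<\theta_0\}$, for each $\theta_0\in(0,\pi/2)$. $\phi_n$ denotes the $n$-th iterate of $\phi$. The notation $d_n\uparrow a$ means that $d_n$ is non-decreasing with limit $a$. *)

theory Defs
  imports "HOL-Analysis.Analysis"
begin

definition upper_halfplane :: "complex set" where
  "upper_halfplane = {z. Im z > 0}"

definition pseudo_hyp_dist :: "complex \<Rightarrow> complex \<Rightarrow> real" where
  "pseudo_hyp_dist z w = cmod ((w - z) / (w - cnj z))"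

(* The values of the map outside the half-plane are irrelevant (HOL functions are total). *)
definition analytic_self_map :: "(complex \<Rightarrow> complex) \<Rightarrow> bool" where
  "analytic_self_map f \<longleftrightarrow>
     f holomorphic_on upper_halfplane \<and> f ` upper_halfplane \<subseteq> upper_halfplane"

definition sector :: "real \<Rightarrow> complex set" where
  "sector \<theta> = {z. \<bar>Arg z - pi / 2\<bar> < \<theta>}"

definition nontangential_limit :: "(complex \<Rightarrow> complex) \<Rightarrow> complex filter \<Rightarrow> bool" where
  "nontangential_limit f F \<longleftrightarrow>
     (\<forall>\<theta>. 0 < \<theta> \<and> \<theta> < pi / 2 \<longrightarrow> filterlim f F (inf at_infinity (principal (sector \<theta>))))"

definition parabolic_self_map :: "(complex \<Rightarrow> complex) \<Rightarrow> bool" where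
  "parabolic_self_map \<phi> \<longleftrightarrow>
     analytic_self_map \<phi> \<and>
     nontangential_limit \<phi> at_infinity \<and>
     nontangential_limit (\<lambda>z. \<phi> z / z) (nhds 1)"

definition backward_iteration_sequence ::
    "(complex \<Rightarrow> complex) \<Rightarrow> (nat \<Rightarrow> complex) \<Rightarrow> bool" where
  "backward_iteration_sequence \<phi> w \<longleftrightarrow>
     (\<forall>n. w n \<in> upper_halfplane) \<and> (\<forall>n. \<phi> (w (Suc n)) = w n)"

definition tau :: "complex \<Rightarrow> complex \<Rightarrow> complex" where
  "tau c z = of_real (Re c) + of_real (Im c) * z"

end

theory Submission
  imports Defs "HOL-Complex_Analysis.Riemann_Mapping"
begin

text \<open>
  Rescale by \<open>u\<^sub>n = \<tau>\<^sub>n\<inverse>(w\<^sub>n\<^sub>+\<^sub>1) = s\<^sub>n + i r\<^sub>n\<close> and consider the self-maps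
  \<open>G\<^sub>n\<^sub>m = \<tau>\<^sub>n\<inverse> \<circ> \<phi>\<^sub>m\<^sub>-\<^sub>n \<circ> \<tau>\<^sub>m\<close>, which fix \<open>i\<close> and send \<open>u\<^sub>m\<close> to \<open>u\<^sub>n\<close>. As \<open>d(i, u\<^sub>n) = d\<^sub>n\<close>
  converges to \<open>a > 0\<close>, the Schwarz--Pick lemma is nearly an equality, so \<open>G\<^sub>n\<^sub>m\<close> is close to an
  elliptic rotation about \<open>i\<close>. By Julia's lemma \<open>\<phi>\<close> does not decrease imaginary parts, which for
  \<open>m = n + 1\<close> forces that rotation to be nearly trivial; hence \<open>u\<^sub>n\<^sub>+\<^sub>1 - u\<^sub>n \<rightarrow> 0\<close>. The monotone sequences
  \<open>d(w\<^sub>n, w\<^sub>n\<^sub>+\<^sub>1)\<close> and \<open>d(w\<^sub>n, w\<^sub>n\<^sub>+\<^sub>2)\<close> then determine the limit of \<open>r\<^sub>n\<close>, and it must be \<open>1\<close>,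
  since otherwise \<open>w\<close> would converge. So \<open>u\<^sub>n \<rightarrow> b\<^sub>0 + i\<close>, the sign being decided by \<open>Arg w\<^sub>n \<rightarrow> 0\<close>. Now
  \<open>G\<^sub>n\<^sub>m\<close> tends to the identity uniformly in \<open>m \<ge> n\<close>, and
  \<open>\<phi>\<^sub>m \<circ> \<tau>\<^sub>m = (\<phi>\<^sub>n \<circ> \<tau>\<^sub>n) \<circ> G\<^sub>n\<^sub>m\<close> shows that the normalized iterates form a Cauchy sequence.
\<close>

section \<open>Distortion of self-maps of the disc\<close>

lemma one_minus_Moebius_norm_sq:
  assumes "norm w < 1" "norm z < 1"
  shows "1 - (norm (Moebius_function 0 w z))\<^sup>2 =
           (1 - (norm w)\<^sup>2) * (1 - (norm z)\<^sup>2) / (norm (1 - cnj w * z))\<^sup>2"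
proof -
  have "cmod (cnj w * z) < 1"
    using norm_mult_less[of "cnj w" 1 z 1] assms by simp
  then have "1 - cnj w * z \<noteq> 0" by auto
  moreover have "(1 - (norm w)\<^sup>2) * (1 - (norm z)\<^sup>2) = (norm (1 - cnj w * z))\<^sup>2 - (norm (z - w))\<^sup>2"
    unfolding cmod_power2 by (simp add: power2_eq_square algebra_simps)
  ultimately show ?thesis
    by (simp add: Moebius_function_simple norm_divide power_divide
        diff_divide_distrib[of "(cmod (1 - cnj w * z))\<^sup>2" "(cmod (z - w))\<^sup>2"])
qed

text \<open>Disc automorphisms moving 0 to \<open>w\<close> before \<open>f\<close> and
  \<open>f w\<close> to 0 after it produce a self-map fixing 0, to which the Schwarz lemma
  applies.\<close>

lemma Schwarz_Pick_disc:
  assumes holf: "f holomorphic_on ball 0 1"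
    and f: "\<And>z. norm z < 1 \<Longrightarrow> norm (f z) < 1"
    and z: "norm z < 1" and w: "norm w < 1"
  shows "norm (Moebius_function 0 (f w) (f z)) \<le> norm (Moebius_function 0 w z)"
proof -
  define g where "g = Moebius_function 0 (f w) \<circ> f \<circ> Moebius_function 0 (- w)"
  have M: "Moebius_function 0 (- w) \<zeta> \<in> ball 0 1" if "\<zeta> \<in> ball 0 1" for \<zeta>
    using that w Moebius_function_norm_lt_1 by simp
  have "g holomorphic_on ball 0 1"
    unfolding g_def
  proof (intro holomorphic_on_compose_gen)
    show "Moebius_function 0 (- w) holomorphic_on ball 0 1"
      using Moebius_function_holomorphic w by simp
    show "f holomorphic_on ball 0 1" by fact
    show "Moebius_function 0 (f w) holomorphic_on ball 0 1"
      using Moebius_function_holomorphic w f by simp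
  qed (use M f in auto)
  moreover have "g 0 = 0"
    by (simp add: g_def Moebius_function_of_zero Moebius_function_eq_zero)
  moreover have "norm (g \<zeta>) < 1" if "norm \<zeta> < 1" for \<zeta>
    using that M f w Moebius_function_norm_lt_1 by (simp add: g_def)
  moreover have "norm (Moebius_function 0 w z) < 1"
    using z w Moebius_function_norm_lt_1 by simp
  ultimately have "norm (g (Moebius_function 0 w z)) \<le> norm (Moebius_function 0 w z)"
    using Schwarz_Lemma(1) by blast
  then show ?thesis
    using z w by (simp add: g_def Moebius_function_compose)
qed

text \<open>A quantitative maximum principle: if \<open>f w\<close> lies near the unit circle, then
  \<open>f\<close> is nearly constant, with a loss governed by the distance from \<open>w\<close> to
  \<open>z\<close>. It follows by rewriting Schwarz-Pick with the identity for one minus the squared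
  distance, where \<open>N\<close> is the denominator at the image points.\<close>

lemma disc_distortion:
  assumes holf: "f holomorphic_on ball 0 1"
    and f: "\<And>z. norm z < 1 \<Longrightarrow> norm (f z) < 1"
    and z: "norm z < 1" and w: "norm w < 1"
  shows "(norm (f z - f w))\<^sup>2 * (1 - (norm (Moebius_function 0 w z))\<^sup>2) \<le> 1 - (norm (f w))\<^sup>2"
proof -
  define N where "N = norm (1 - cnj (f w) * f z)"
  have fz: "norm (f z) < 1" and fw: "norm (f w) < 1" using f z w by auto
  have fwz: "0 < 1 - (norm (f w))\<^sup>2" "0 < 1 - (norm (f z))\<^sup>2"
    using fz fw by (simp_all add: abs_square_less_1)
  have "cmod (cnj (f w) * f z) < 1"
    using norm_mult_less[of "cnj (f w)" 1 "f z" 1] fz fw by simp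
  then have "N > 0" unfolding N_def by auto
  have M: "norm (Moebius_function 0 (f w) (f z)) = norm (f z - f w) / N"
    by (simp add: Moebius_function_simple norm_divide N_def)
  have le: "(norm (Moebius_function 0 (f w) (f z)))\<^sup>2 \<le> (norm (Moebius_function 0 w z))\<^sup>2"
    using Schwarz_Pick_disc[OF assms] by (simp add: power_mono)
  have id: "1 - (norm (Moebius_function 0 (f w) (f z)))\<^sup>2
             = (1 - (norm (f w))\<^sup>2) * (1 - (norm (f z))\<^sup>2) / N\<^sup>2"
    using one_minus_Moebius_norm_sq[OF fw fz] unfolding N_def .
  have "0 < 1 - (norm (Moebius_function 0 (f w) (f z)))\<^sup>2"
    unfolding id using fwz \<open>N > 0\<close> by (intro divide_pos_pos mult_pos_pos) auto
  then have "norm (f z - f w) / N \<le> 1"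
    unfolding M[symmetric] by (simp add: abs_square_less_1 less_imp_le)
  then have dN: "norm (f z - f w) \<le> N" using \<open>N > 0\<close> by (simp add: divide_simps)
  have "0 \<le> 1 - (norm (Moebius_function 0 w z))\<^sup>2"
    using Moebius_function_norm_lt_1[OF w z] by (simp add: abs_square_le_1 less_imp_le)
  then have "(norm (f z - f w))\<^sup>2 * (1 - (norm (Moebius_function 0 w z))\<^sup>2)
        \<le> N\<^sup>2 * (1 - (norm (Moebius_function 0 w z))\<^sup>2)"
    using dN by (intro mult_right_mono power_mono) auto
  also have "\<dots> \<le> N\<^sup>2 * (1 - (norm (Moebius_function 0 (f w) (f z)))\<^sup>2)"
    using le by (intro mult_left_mono) auto
  also have "\<dots> = (1 - (norm (f w))\<^sup>2) * (1 - (norm (f z))\<^sup>2)"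
    unfolding id using \<open>N > 0\<close> by simp
  also have "\<dots> \<le> 1 - (norm (f w))\<^sup>2"
    using fwz by (simp add: mult_left_le)
  finally show ?thesis .
qed

lemma disc_distortion_closed:
  assumes holf: "f holomorphic_on ball 0 1"
    and f: "\<And>z. norm z < 1 \<Longrightarrow> norm (f z) \<le> 1"
    and z: "norm z < 1" and w: "norm w < 1"
  shows "(norm (f z - f w))\<^sup>2 * (1 - (norm (Moebius_function 0 w z))\<^sup>2) \<le> 1 - (norm (f w))\<^sup>2"
proof -
  define s where "s = 1 - (norm (Moebius_function 0 w z))\<^sup>2"
  have scaled: "(c * norm (f z - f w))\<^sup>2 * s \<le> 1 - (c * norm (f w))\<^sup>2"
    if c: "0 < c" "c < 1" for c :: real
  proof -
    have "norm (of_real c * f \<zeta>) < 1" if "norm \<zeta> < 1" for \<zeta>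
      using f[OF that] c mult_le_one[of c "norm (f \<zeta>)"]
      by (simp add: norm_mult) (metis less_eq_real_def mult.right_neutral mult_le_cancel_left_pos order_le_less_trans)
    then have "(norm (of_real c * f z - of_real c * f w))\<^sup>2 * s \<le> 1 - (norm (of_real c * f w))\<^sup>2"
      unfolding s_def using holf z w
      by (intro disc_distortion[where f = "\<lambda>z. of_real c * f z"]) (auto intro!: holomorphic_intros)
    then show ?thesis
      using c by (simp add: norm_mult flip: right_diff_distrib)
  qed
  have "(1 * norm (f z - f w))\<^sup>2 * s \<le> 1 - (1 * norm (f w))\<^sup>2"
  proof (rule tendsto_le[of "at_left (1::real)"])
    show "((\<lambda>c. 1 - (c * norm (f w))\<^sup>2) \<longlongrightarrow> 1 - (1 * norm (f w))\<^sup>2) (at_left 1)"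
      "((\<lambda>c. (c * norm (f z - f w))\<^sup>2 * s) \<longlongrightarrow> (1 * norm (f z - f w))\<^sup>2 * s) (at_left 1)"
      by (intro tendsto_intros)+
    show "\<forall>\<^sub>F c in at_left 1. (c * norm (f z - f w))\<^sup>2 * s \<le> 1 - (c * norm (f w))\<^sup>2"
      using eventually_at_left_real[of 0 "1::real"] scaled by (auto elim!: eventually_mono)
  qed auto
  then show ?thesis by (simp add: s_def)
qed

text \<open>A stable form of the equality case of the Schwarz lemma, obtained by applying the
  distortion bound to the Schwarz quotient \<open>f z / z\<close>: if the modulus of
  \<open>f w\<close> is close to that of \<open>w\<close>, then \<open>f\<close> is close to
  multiplication by \<open>f w / w\<close>.\<close>

lemma disc_rigidity:
  assumes holf: "f holomorphic_on ball 0 1" and f0: "f 0 = 0"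
    and f: "\<And>z. norm z < 1 \<Longrightarrow> norm (f z) < 1"
    and z: "norm z < 1" "z \<noteq> 0" and w: "norm w < 1" "w \<noteq> 0"
  shows "(norm (f z / z - f w / w))\<^sup>2 * (1 - (norm (Moebius_function 0 w z))\<^sup>2)
           \<le> 1 - (norm (f w / w))\<^sup>2"
proof -
  obtain h where h: "h holomorphic_on ball 0 1" "\<And>z. norm z < 1 \<Longrightarrow> f z = z * h z" "deriv f 0 = h 0"
    using Schwarz3[OF holf f0] by blast
  have "norm (h \<zeta>) \<le> 1" if "norm \<zeta> < 1" for \<zeta>
  \<comment> \<open>At 0 the quotient is the derivative of \<open>f\<close>, which the Schwarz lemma
    bounds separately.\<close>
  proof (cases "\<zeta> = 0")
    case True
    then show ?thesis using Schwarz_Lemma(2)[OF holf f0 f, of 0] h(3) by simp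
  next
    case False
    then show ?thesis
      using Schwarz_Lemma(1)[OF holf f0 f that] h(2)[OF that] by (simp add: norm_mult)
  qed
  from disc_distortion_closed[OF h(1) this z(1) w(1)] show ?thesis
    using h(2)[OF z(1)] h(2)[OF w(1)] z w by simp
qed

section \<open>The pseudo-hyperbolic distance on the upper half-plane\<close>

definition cayley :: "complex \<Rightarrow> complex" where
  "cayley z = (z - \<i>) / (z + \<i>)"

definition inv_cayley :: "complex \<Rightarrow> complex" where
  "inv_cayley \<zeta> = \<i> * (1 + \<zeta>) / (1 - \<zeta>)"

lemma upper_halfplane_plus_ii_nonzero: "z \<in> upper_halfplane \<Longrightarrow> z + \<i> \<noteq> 0"
  by (auto simp: upper_halfplane_def complex_eq_iff)

lemma upper_halfplane_minus_cnj_nonzero: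
  "z \<in> upper_halfplane \<Longrightarrow> w \<in> upper_halfplane \<Longrightarrow> w - cnj z \<noteq> 0"
  by (auto simp: upper_halfplane_def complex_eq_iff)

lemma open_upper_halfplane: "open upper_halfplane"
  unfolding upper_halfplane_def by (rule open_halfspace_Im_gt)

lemma one_minus_pseudo_hyp_dist_sq:
  assumes "z \<in> upper_halfplane" "w \<in> upper_halfplane"
  shows "1 - (pseudo_hyp_dist z w)\<^sup>2 = 4 * Im z * Im w / (norm (w - cnj z))\<^sup>2"
proof -
  have "4 * Im z * Im w = (norm (w - cnj z))\<^sup>2 - (norm (w - z))\<^sup>2"
    unfolding cmod_power2 by (simp add: power2_eq_square algebra_simps)
  then show ?thesis
    using upper_halfplane_minus_cnj_nonzero[OF assms]
    by (simp add: pseudo_hyp_dist_def norm_divide power_divide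
        diff_divide_distrib[of "(cmod (w - cnj z))\<^sup>2" "(cmod (w - z))\<^sup>2"])
qed

lemma pseudo_hyp_dist_nonneg: "0 \<le> pseudo_hyp_dist z w"
  by (simp add: pseudo_hyp_dist_def)

lemma pseudo_hyp_dist_less_1:
  assumes "z \<in> upper_halfplane" "w \<in> upper_halfplane"
  shows "pseudo_hyp_dist z w < 1"
proof -
  have "0 < 1 - (pseudo_hyp_dist z w)\<^sup>2"
    unfolding one_minus_pseudo_hyp_dist_sq[OF assms]
    using assms upper_halfplane_minus_cnj_nonzero[OF assms]
    by (auto simp: upper_halfplane_def intro!: divide_pos_pos mult_pos_pos)
  then show ?thesis using pseudo_hyp_dist_nonneg[of z w] by (simp add: abs_square_less_1)
qed

lemma norm_cayley: "norm (cayley z) = pseudo_hyp_dist \<i> z"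
  by (simp add: cayley_def pseudo_hyp_dist_def)

lemma norm_cayley_less_1: "z \<in> upper_halfplane \<Longrightarrow> norm (cayley z) < 1"
  unfolding norm_cayley by (rule pseudo_hyp_dist_less_1) (auto simp: upper_halfplane_def)

lemma cayley_eq_0_iff: "z \<in> upper_halfplane \<Longrightarrow> cayley z = 0 \<longleftrightarrow> z = \<i>"
  using upper_halfplane_plus_ii_nonzero by (simp add: cayley_def)

lemma inv_cayley_in_upper_halfplane:
  assumes "norm \<zeta> < 1" shows "inv_cayley \<zeta> \<in> upper_halfplane"
proof -
  have "\<zeta> \<noteq> 1" using assms by auto
  then have nz: "(Re (1 - \<zeta>))\<^sup>2 + (Im (1 - \<zeta>))\<^sup>2 > 0"
    by (auto simp: complex_eq_iff sum_power2_gt_zero_iff)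
  have "(Re \<zeta>)\<^sup>2 + (Im \<zeta>)\<^sup>2 < 1"
    using assms by (metis cmod_power2 norm_ge_zero abs_square_less_1 abs_norm_cancel)
  then have "Im (inv_cayley \<zeta>) > 0"
    using nz unfolding inv_cayley_def Im_divide
    by (intro divide_pos_pos) (auto simp: power2_eq_square algebra_simps)
  then show ?thesis by (simp add: upper_halfplane_def)
qed

lemma inv_cayley_cayley: "z \<in> upper_halfplane \<Longrightarrow> inv_cayley (cayley z) = z"
  using upper_halfplane_plus_ii_nonzero[of z]
  by (simp add: inv_cayley_def cayley_def divide_simps)

lemma norm_Moebius_cayley:
  assumes "z \<in> upper_halfplane" "w \<in> upper_halfplane"
  shows "norm (Moebius_function 0 (cayley z) (cayley w)) = pseudo_hyp_dist z w"
proof -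
  have nz: "w + \<i> \<noteq> 0" "z + \<i> \<noteq> 0" "cnj z - \<i> \<noteq> 0"
    using assms upper_halfplane_plus_ii_nonzero by (auto simp: upper_halfplane_def complex_eq_iff)
  have 1: "cayley w - cayley z = 2 * \<i> * (w - z) / ((w + \<i>) * (z + \<i>))"
    using nz by (simp add: cayley_def divide_simps) (simp add: algebra_simps)
  have 2: "1 - cnj (cayley z) * cayley w = -2 * \<i> * (w - cnj z) / ((w + \<i>) * (cnj z - \<i>))"
    using nz by (simp add: cayley_def divide_simps) (simp add: algebra_simps)
  have 3: "norm (cnj z - \<i>) = norm (z + \<i>)"
    by (metis complex_cnj_add complex_cnj_i complex_mod_cnj diff_conv_add_uminus)
  show ?thesis
    using nz unfolding Moebius_function_simple 1 2 pseudo_hyp_dist_def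
    by (simp add: norm_divide norm_mult 3)
qed

lemma disc_conjugate:
  assumes f: "analytic_self_map f"
  shows "(cayley \<circ> f \<circ> inv_cayley) holomorphic_on ball 0 1"
    and "norm \<zeta> < 1 \<Longrightarrow> norm ((cayley \<circ> f \<circ> inv_cayley) \<zeta>) < 1"
proof -
  have f': "f holomorphic_on upper_halfplane" "f ` upper_halfplane \<subseteq> upper_halfplane"
    using f by (auto simp: analytic_self_map_def)
  show "(cayley \<circ> f \<circ> inv_cayley) holomorphic_on ball 0 1"
  proof (intro holomorphic_on_compose_gen)
    show "inv_cayley holomorphic_on ball 0 1"
      unfolding inv_cayley_def by (intro holomorphic_intros) auto
    show "cayley holomorphic_on upper_halfplane"
      unfolding cayley_def using upper_halfplane_plus_ii_nonzero by (intro holomorphic_intros) auto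
  qed (use f' inv_cayley_in_upper_halfplane in auto)
  show "norm \<zeta> < 1 \<Longrightarrow> norm ((cayley \<circ> f \<circ> inv_cayley) \<zeta>) < 1"
    using f' inv_cayley_in_upper_halfplane norm_cayley_less_1 by (auto simp: image_subset_iff)
qed

lemma Schwarz_Pick_halfplane:
  assumes f: "analytic_self_map f" and z: "z \<in> upper_halfplane" and w: "w \<in> upper_halfplane"
  shows "pseudo_hyp_dist (f z) (f w) \<le> pseudo_hyp_dist z w"
proof -
  have "f z \<in> upper_halfplane" "f w \<in> upper_halfplane"
    using assms by (auto simp: analytic_self_map_def)
  then show ?thesis
    using Schwarz_Pick_disc[OF disc_conjugate[OF f], of "cayley w" "cayley z"] z w
    by (simp add: norm_cayley_less_1 inv_cayley_cayley norm_Moebius_cayley)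
qed

text \<open>In the Cayley coordinate \<open>f\<close> fixes 0. The right-hand side measures how far
  Schwarz-Pick is from equality at the pair formed by \<i> and \<open>w\<close>; the left-hand side
  measures how far \<open>f\<close> is at \<open>z\<close> from the elliptic rotation about \<i>
  suggested by its value at \<open>w\<close>.\<close>

lemma halfplane_rigidity:
  assumes f: "analytic_self_map f" and fi: "f \<i> = \<i>"
    and z: "z \<in> upper_halfplane" "z \<noteq> \<i>" and w: "w \<in> upper_halfplane" "w \<noteq> \<i>"
  shows "(norm (cayley (f z) / cayley z - cayley (f w) / cayley w))\<^sup>2 * (1 - (pseudo_hyp_dist w z)\<^sup>2)
           \<le> 1 - (pseudo_hyp_dist \<i> (f w) / pseudo_hyp_dist \<i> w)\<^sup>2"
proof -
  have "(cayley \<circ> f \<circ> inv_cayley) 0 = 0" by (simp add: inv_cayley_def fi cayley_def)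
  from disc_rigidity[OF disc_conjugate(1)[OF f] this disc_conjugate(2)[OF f], of "cayley z" "cayley w"]
  show ?thesis using z w
      norm_cayley_less_1[OF z(1)] norm_cayley_less_1[OF w(1)]
    by (simp add: inv_cayley_cayley cayley_eq_0_iff norm_Moebius_cayley norm_divide norm_cayley)
qed

lemma analytic_self_map_compose:
  assumes "analytic_self_map f" "analytic_self_map g"
  shows "analytic_self_map (f \<circ> g)"
  using assms unfolding analytic_self_map_def
  by (auto intro: holomorphic_on_compose_gen simp: image_subset_iff)

lemma analytic_self_map_funpow:
  assumes "analytic_self_map f" shows "analytic_self_map (f ^^ n)"
proof (induction n)
  case 0
  then show ?case by (simp add: analytic_self_map_def id_def)
next
  case (Suc n)
  then show ?case using analytic_self_map_compose[OF assms, of "f ^^ n"] by (simp add: comp_def)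
qed

lemma analytic_self_map_in:
  "analytic_self_map f \<Longrightarrow> z \<in> upper_halfplane \<Longrightarrow> f z \<in> upper_halfplane"
  by (auto simp: analytic_self_map_def)

text \<open>The denominator of the distance is at most \<open>norm (w - z) + 2 * Im z\<close>; the
  resulting linear inequality is solved for \<open>norm (w - z)\<close>.\<close>

lemma norm_diff_le_pseudo_hyp_dist:
  assumes z: "z \<in> upper_halfplane" and w: "w \<in> upper_halfplane"
    and \<rho>: "pseudo_hyp_dist z w \<le> \<rho>" "\<rho> < 1"
  shows "norm (w - z) \<le> 2 * \<rho> * Im z / (1 - \<rho>)"
proof -
  have "norm (w - z) = pseudo_hyp_dist z w * norm (w - cnj z)"
    using upper_halfplane_minus_cnj_nonzero[OF z w]
    by (simp add: pseudo_hyp_dist_def norm_divide)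
  also have "\<dots> \<le> \<rho> * (norm (w - z) + 2 * Im z)"
  proof (rule mult_mono)
    have "w - cnj z = (w - z) + 2 * \<i> * of_real (Im z)" by (simp add: complex_eq_iff)
    then have "norm (w - cnj z) \<le> norm (w - z) + norm (2 * \<i> * of_real (Im z))"
      by (metis norm_triangle_ineq)
    then show "norm (w - cnj z) \<le> norm (w - z) + 2 * Im z"
      using z by (simp add: norm_mult upper_halfplane_def)
  qed (use \<rho> z pseudo_hyp_dist_nonneg[of z w] in auto)
  finally show ?thesis using \<rho> by (simp add: field_simps)
qed

text \<open>A point at controlled distance from \<open>z\<close> stays away from the real axis,
  because \<open>w - cnj z\<close> has imaginary part at least \<open>Im z\<close>.\<close>

lemma Im_ge_pseudo_hyp_dist:
  assumes z: "z \<in> upper_halfplane" and w: "w \<in> upper_halfplane"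
  shows "(1 - (pseudo_hyp_dist z w)\<^sup>2) * Im z / 4 \<le> Im w"
proof -
  have pos: "Im z > 0" "Im w > 0" using z w by (auto simp: upper_halfplane_def)
  have "Im z \<le> \<bar>Im (w - cnj z)\<bar>" using pos by simp
  then have le: "Im z \<le> norm (w - cnj z)" using abs_Im_le_cmod order_trans by blast
  have "(1 - (pseudo_hyp_dist z w)\<^sup>2) * Im z / 4 = Im w * ((Im z)\<^sup>2 / (norm (w - cnj z))\<^sup>2)"
    unfolding one_minus_pseudo_hyp_dist_sq[OF z w] by (simp add: power2_eq_square)
  also have "\<dots> \<le> Im w * 1"
    using pos le by (intro mult_left_mono) (auto simp: divide_le_eq_1 power_mono)
  finally show ?thesis by simp
qed

text \<open>This is \<open>sinh\<^sup>2\<close> of half the hyperbolic distance.\<close>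
definition sinh_sq_dist :: "complex \<Rightarrow> complex \<Rightarrow> real" where
  "sinh_sq_dist z w = (norm (w - z))\<^sup>2 / (4 * Im z * Im w)"

lemma sinh_sq_dist_eq:
  assumes z: "z \<in> upper_halfplane" and w: "w \<in> upper_halfplane"
  shows "sinh_sq_dist z w = (pseudo_hyp_dist z w)\<^sup>2 / (1 - (pseudo_hyp_dist z w)\<^sup>2)"
  using upper_halfplane_minus_cnj_nonzero[OF assms] 
  unfolding one_minus_pseudo_hyp_dist_sq[OF assms]
  by (simp add: sinh_sq_dist_def pseudo_hyp_dist_def norm_divide power_divide)

lemma sinh_sq_dist_mono:
  assumes f: "analytic_self_map f" and z: "z \<in> upper_halfplane" and w: "w \<in> upper_halfplane"
  shows "sinh_sq_dist (f z) (f w) \<le> sinh_sq_dist z w"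
proof -
  have fz: "f z \<in> upper_halfplane" "f w \<in> upper_halfplane"
    using assms analytic_self_map_in by auto
  have sq: "(pseudo_hyp_dist (f z) (f w))\<^sup>2 \<le> (pseudo_hyp_dist z w)\<^sup>2"
    using Schwarz_Pick_halfplane[OF assms] pseudo_hyp_dist_nonneg by (intro power_mono)
  have "(pseudo_hyp_dist z w)\<^sup>2 < 1"
    using pseudo_hyp_dist_less_1[OF z w] pseudo_hyp_dist_nonneg[of z w] by (simp add: abs_square_less_1)
  then show ?thesis
    unfolding sinh_sq_dist_eq[OF z w] sinh_sq_dist_eq[OF fz] using sq by (intro frac_le) auto
qed

section \<open>Estimates on compact sets and convergence\<close>

lemma ii_in: "\<i> \<in> upper_halfplane"
  by (simp add: upper_halfplane_def)

lemma compact_dist_ii: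
  assumes "compact K" "K \<subseteq> upper_halfplane"
  obtains \<rho> where "0 < \<rho>" "\<rho> < 1" "\<And>z. z \<in> K \<Longrightarrow> pseudo_hyp_dist \<i> z \<le> \<rho>"
proof (cases "K = {}")
  case False
  have "continuous_on K (pseudo_hyp_dist \<i>)"
    unfolding pseudo_hyp_dist_def
    using upper_halfplane_minus_cnj_nonzero[OF ii_in] assms(2)
    by (intro continuous_intros) auto
  then obtain z0 where z0: "z0 \<in> K" "\<And>z. z \<in> K \<Longrightarrow> pseudo_hyp_dist \<i> z \<le> pseudo_hyp_dist \<i> z0"
    using continuous_attains_sup[OF assms(1) False] by blast
  have "pseudo_hyp_dist \<i> z0 < 1"
    using z0(1) assms(2) pseudo_hyp_dist_less_1[OF ii_in] by auto
  \<comment> \<open>The value 1/2 only keeps the bound positive, as for \<open>K = {\<i>}\<close>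
    the supremum is 0.\<close>
  then have "max (pseudo_hyp_dist \<i> z0) (1/2) < 1" by simp
  then show ?thesis using that[of "max (pseudo_hyp_dist \<i> z0) (1/2)"] z0(2) by fastforce
qed (use that[of "1/2"] in auto)

text \<open>The denominator of the distance between the Cayley images has modulus at least
  \<open>1 - \<rho>\<close>, so an estimate of the difference in the disc suffices.\<close>

lemma dist_le_cayley_diff:
  assumes "z \<in> upper_halfplane" "v \<in> upper_halfplane" "pseudo_hyp_dist \<i> z \<le> \<rho>" "\<rho> < 1"
  shows "pseudo_hyp_dist z v \<le> norm (cayley v - cayley z) / (1 - \<rho>)"
proof -
  have "norm (cnj (cayley z) * cayley v) \<le> \<rho> * 1"
    unfolding norm_mult using assms norm_cayley_less_1[of v] by (intro mult_mono) (auto simp: norm_cayley intro: order_trans[OF pseudo_hyp_dist_nonneg])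
  then have "1 - \<rho> \<le> norm (1 - cnj (cayley z) * cayley v)"
    using norm_triangle_ineq2[of 1 "cnj (cayley z) * cayley v"] by simp
  then have "norm (Moebius_function 0 (cayley z) (cayley v)) \<le> norm (cayley v - cayley z) / (1 - \<rho>)"
    using assms(4) by (simp add: Moebius_function_simple norm_divide frac_le)
  then show ?thesis by (simp add: norm_Moebius_cayley assms)
qed

lemma tendsto_of_pseudo_hyp_dist:
  assumes "z \<in> upper_halfplane" "\<And>n. v n \<in> upper_halfplane"
    and lim: "(\<lambda>n. pseudo_hyp_dist z (v n)) \<longlonglongrightarrow> 0"
  shows "v \<longlonglongrightarrow> z"
proof (rule LIM_zero_cancel, rule Lim_null_comparison)
  let ?p = "\<lambda>n. pseudo_hyp_dist z (v n)"
  show "\<forall>\<^sub>F n in sequentially. norm (v n - z) \<le> 2 * ?p n * Im z / (1 - ?p n)"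
    using assms pseudo_hyp_dist_less_1 norm_diff_le_pseudo_hyp_dist by (intro always_eventually) auto
  have "(\<lambda>n. 2 * ?p n * Im z / (1 - ?p n)) \<longlonglongrightarrow> 2 * 0 * Im z / (1 - 0)"
    by (intro tendsto_intros lim) auto
  then show "(\<lambda>n. 2 * ?p n * Im z / (1 - ?p n)) \<longlonglongrightarrow> 0" by simp
qed

lemma pseudo_hyp_dist_tendsto_0:
  assumes "v \<longlonglongrightarrow> z" "z \<in> upper_halfplane"
  shows "(\<lambda>n. pseudo_hyp_dist (v n) z) \<longlonglongrightarrow> 0"
proof -
  have "(\<lambda>n. pseudo_hyp_dist (v n) z) \<longlonglongrightarrow> norm ((z - z) / (z - cnj z))"
    unfolding pseudo_hyp_dist_def
    using assms upper_halfplane_minus_cnj_nonzero by (intro tendsto_intros) auto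
  then show ?thesis by simp
qed

text \<open>Julia's lemma: compare \<open>z\<close> with the point \<open>\<i>T\<close> by Schwarz--Pick and let \<open>T \<rightarrow> \<infinity>\<close>.\<close>
lemma Im_le_Im_parabolic:
  assumes f: "analytic_self_map f" and lim: "nontangential_limit (\<lambda>z. f z / z) (nhds 1)"
    and z: "z \<in> upper_halfplane"
  shows "Im z \<le> Im (f z)"
proof -
  define q where "q T = f (\<i> * of_real T) / (\<i> * of_real T)" for T :: real
  \<comment> \<open>The imaginary axis lies in every sector, so the aperture \<open>pi/4\<close> is
    an arbitrary choice.\<close>
  have "filterlim (\<lambda>T::real. \<i> * of_real T) (inf at_infinity (principal (sector (pi/4)))) at_top"
  proof (subst filterlim_inf, intro conjI)
    show "filterlim (\<lambda>T::real. \<i> * of_real T) at_infinity at_top"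
      by (intro tendsto_mult_filterlim_at_infinity[of _ \<i>] tendsto_const)
         (auto simp: filterlim_at_infinity_conv_norm_at_top filterlim_abs_real)
    have "Arg (\<i> * of_real T) = pi / 2" if "T > 0" for T :: real
      using that Arg_times_of_real2[of T \<i>] by simp
    then show "filterlim (\<lambda>T::real. \<i> * of_real T) (principal (sector (pi/4))) at_top"
      unfolding filterlim_principal
      by (auto simp: sector_def intro!: eventually_mono[OF eventually_gt_at_top[of 0]])
  qed
  moreover have "filterlim (\<lambda>z. f z / z) (nhds 1) (inf at_infinity (principal (sector (pi/4))))"
    using lim unfolding nontangential_limit_def by simp
  ultimately have q: "(q \<longlongrightarrow> 1) at_top"
    unfolding q_def by (rule filterlim_compose[rotated])
  have inv: "((\<lambda>T. c / of_real T) \<longlongrightarrow> 0) at_top" for c :: complex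
    using tendsto_mult[OF tendsto_const[of c] tendsto_of_real[OF tendsto_inverse_0_at_top[OF filterlim_ident]]]
    by (simp add: divide_inverse)
  have fz: "f z \<in> upper_halfplane" using f z analytic_self_map_in by auto
  have ineq: "Im z / (norm (\<i> - cnj z / of_real T))\<^sup>2
           \<le> Im (f z) * Re (q T) / (norm (\<i> * q T - cnj (f z) / of_real T))\<^sup>2" if T: "T > 0" for T :: real
  proof -
    let ?p = "\<i> * of_real T"
    have p: "?p \<in> upper_halfplane" using T by (simp add: upper_halfplane_def)
    have fp: "f ?p \<in> upper_halfplane" using f p analytic_self_map_in by auto
    have "(pseudo_hyp_dist (f z) (f ?p))\<^sup>2 \<le> (pseudo_hyp_dist z ?p)\<^sup>2"
      using Schwarz_Pick_halfplane[OF f z p] pseudo_hyp_dist_nonneg by (intro power_mono)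
    then have le: "Im z * T / (norm (?p - cnj z))\<^sup>2 \<le> Im (f z) * Im (f ?p) / (norm (f ?p - cnj (f z)))\<^sup>2"
      using one_minus_pseudo_hyp_dist_sq[OF z p] one_minus_pseudo_hyp_dist_sq[OF fz fp] by simp
    have 1: "norm (?p - cnj z) = T * norm (\<i> - cnj z / of_real T)"
    proof -
      have "?p - cnj z = of_real T * (\<i> - cnj z / of_real T)" using T by (simp add: field_simps)
      then show ?thesis using T by (simp add: norm_mult)
    qed
    have fp_eq: "f ?p = \<i> * of_real T * q T" using T by (simp add: q_def)
    have 2: "norm (f ?p - cnj (f z)) = T * norm (\<i> * q T - cnj (f z) / of_real T)"
    proof -
      have "f ?p - cnj (f z) = of_real T * (\<i> * q T - cnj (f z) / of_real T)"
        using T unfolding fp_eq by (simp add: field_simps)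
      then show ?thesis using T by (simp add: norm_mult)
    qed
    have 3: "Im (f ?p) = T * Re (q T)" unfolding fp_eq by simp
    \<comment> \<open>Both sides decay like \<open>1 / T\<close>; multiplying by \<open>T\<close>
      leaves finite nonzero limits.\<close>
    have "T * (Im z * T / (norm (?p - cnj z))\<^sup>2) \<le> T * (Im (f z) * Im (f ?p) / (norm (f ?p - cnj (f z)))\<^sup>2)"
      using le T by (intro mult_left_mono) auto
    then show ?thesis using T unfolding 1 2 3 by (simp add: power_mult_distrib power2_eq_square)
  qed
  have "Im z / (norm (\<i> - 0))\<^sup>2 \<le> Im (f z) * Re 1 / (norm (\<i> * 1 - 0))\<^sup>2"
  proof (rule tendsto_le[of "at_top :: real filter"])
    show "((\<lambda>T. Im (f z) * Re (q T) / (norm (\<i> * q T - cnj (f z) / of_real T))\<^sup>2)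
            \<longlongrightarrow> Im (f z) * Re 1 / (norm (\<i> * 1 - 0))\<^sup>2) at_top"
      by (intro tendsto_intros q inv) auto
    show "((\<lambda>T. Im z / (norm (\<i> - cnj z / of_real T))\<^sup>2) \<longlongrightarrow> Im z / (norm (\<i> - 0))\<^sup>2) at_top"
      by (intro tendsto_intros inv) auto
    show "\<forall>\<^sub>F T in at_top. Im z / (norm (\<i> - cnj z / of_real T))\<^sup>2
           \<le> Im (f z) * Re (q T) / (norm (\<i> * q T - cnj (f z) / of_real T))\<^sup>2"
      using ineq by (rule eventually_mono[OF eventually_gt_at_top[of 0]])
  qed auto
  then show ?thesis by simp
qed

section \<open>The affine normalizations\<close>

definition tau_inv :: "complex \<Rightarrow> complex \<Rightarrow> complex" where
  "tau_inv c z = (z - of_real (Re c)) / of_real (Im c)"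

lemma tau_inv_tau: "c \<in> upper_halfplane \<Longrightarrow> tau_inv c (tau c z) = z"
  by (auto simp: tau_inv_def tau_def upper_halfplane_def)

lemma tau_tau_inv: "c \<in> upper_halfplane \<Longrightarrow> tau c (tau_inv c z) = z"
  by (auto simp: tau_inv_def tau_def upper_halfplane_def)

lemma tau_ii: "tau c \<i> = c"
  by (simp add: tau_def complex_eq_iff)

lemma tau_inv_self: "c \<in> upper_halfplane \<Longrightarrow> tau_inv c c = \<i>"
  by (metis tau_ii tau_inv_tau)

lemma Im_tau: "Im (tau c z) = Im c * Im z"
  by (simp add: tau_def)

lemma Re_tau_inv: "Re (tau_inv c z) = (Re z - Re c) / Im c"
  by (simp add: tau_inv_def)

lemma Im_tau_inv: "Im (tau_inv c z) = Im z / Im c"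
  by (simp add: tau_inv_def)

lemma analytic_self_map_tau: "c \<in> upper_halfplane \<Longrightarrow> analytic_self_map (tau c)"
  unfolding analytic_self_map_def
  by (auto simp: Im_tau upper_halfplane_def intro!: holomorphic_intros)
     (auto simp: tau_def[abs_def] intro!: holomorphic_intros)

lemma analytic_self_map_tau_inv: "c \<in> upper_halfplane \<Longrightarrow> analytic_self_map (tau_inv c)"
  unfolding analytic_self_map_def
  by (auto simp: Im_tau_inv upper_halfplane_def)
     (auto simp: tau_inv_def[abs_def] intro!: holomorphic_intros)

text \<open>Both the normalization and its inverse are self-maps, so Schwarz-Pick gives the two
  inequalities.\<close>

lemma pseudo_hyp_dist_tau_inv:
  assumes "c \<in> upper_halfplane" "z \<in> upper_halfplane" "w \<in> upper_halfplane"
  shows "pseudo_hyp_dist (tau_inv c z) (tau_inv c w) = pseudo_hyp_dist z w"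
proof (rule antisym)
  have "pseudo_hyp_dist (tau c (tau_inv c z)) (tau c (tau_inv c w))
          \<le> pseudo_hyp_dist (tau_inv c z) (tau_inv c w)"
    using assms analytic_self_map_in analytic_self_map_tau_inv
    by (intro Schwarz_Pick_halfplane analytic_self_map_tau) auto
  then show "pseudo_hyp_dist z w \<le> pseudo_hyp_dist (tau_inv c z) (tau_inv c w)"
    using assms by (simp add: tau_tau_inv)
qed (use assms in \<open>auto intro!: Schwarz_Pick_halfplane analytic_self_map_tau_inv\<close>)

section \<open>Limits of the normalized steps\<close>

locale backward_orbit =
  fixes \<phi> :: "complex \<Rightarrow> complex" and w :: "nat \<Rightarrow> complex" and a :: real
  assumes self_map: "analytic_self_map \<phi>"
    and Im_increasing: "\<And>z. z \<in> upper_halfplane \<Longrightarrow> Im z \<le> Im (\<phi> z)"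
    and orbit: "\<And>n. w n \<in> upper_halfplane" "\<And>n. \<phi> (w (Suc n)) = w n"
    and step_incseq: "incseq (\<lambda>n. pseudo_hyp_dist (w n) (w (Suc n)))"
    and step_lim: "(\<lambda>n. pseudo_hyp_dist (w n) (w (Suc n))) \<longlonglongrightarrow> a"
    and a_less_1: "a < 1"
    and w_infinity: "filterlim w at_infinity sequentially"
    and Arg_lim: "(\<lambda>n. Arg (w n)) \<longlonglongrightarrow> 0"
begin

definition d :: "nat \<Rightarrow> real" where
  "d n = pseudo_hyp_dist (w n) (w (Suc n))"

definition u :: "nat \<Rightarrow> complex" where
  "u n = tau_inv (w n) (w (Suc n))"

definition s :: "nat \<Rightarrow> real" where
  "s n = (Re (w (Suc n)) - Re (w n)) / Im (w n)"

definition r :: "nat \<Rightarrow> real" where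
  "r n = Im (w (Suc n)) / Im (w n)"

definition D :: "nat \<Rightarrow> real" where
  "D n = sinh_sq_dist (w n) (w (Suc n))"

definition G :: "nat \<Rightarrow> nat \<Rightarrow> complex \<Rightarrow> complex" where
  "G n m = tau_inv (w n) \<circ> (\<phi> ^^ (m - n)) \<circ> tau (w m)"

section \<open>Bounds for a single step\<close>

lemma Im_w_pos: "Im (w n) > 0"
  using orbit(1)[of n] by (simp add: upper_halfplane_def)

lemma u_in: "u n \<in> upper_halfplane"
  unfolding u_def using analytic_self_map_in[OF analytic_self_map_tau_inv] orbit by blast

lemma Re_u: "Re (u n) = s n" and Im_u: "Im (u n) = r n"
  by (simp_all add: u_def s_def r_def Re_tau_inv Im_tau_inv)

lemma norm_cayley_u: "norm (cayley (u n)) = d n"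
  unfolding norm_cayley u_def d_def
  using pseudo_hyp_dist_tau_inv[of "w n" "w n" "w (Suc n)"] orbit by (simp add: tau_inv_self)

lemma d_nonneg: "0 \<le> d n"
  by (simp add: d_def pseudo_hyp_dist_nonneg)

lemma d_mono: "m \<le> n \<Longrightarrow> d m \<le> d n"
  using step_incseq by (simp add: d_def incseq_def)

lemma d_lim: "d \<longlonglongrightarrow> a"
  using step_lim by (simp add: d_def[abs_def])

lemma d_le_a: "d n \<le> a"
  using incseq_le[OF step_incseq step_lim] by (simp add: d_def)

text \<open>By monotonicity the limit bounds every step from above. If it were 0, all steps would
  vanish and \<open>w\<close> would be constant instead of tending to infinity.\<close>

lemma a_pos: "0 < a"
proof (rule ccontr)
  assume "\<not> 0 < a"
  then have d0: "d n = 0" for n using d_nonneg[of n] d_le_a[of n] by simp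
  have "w (Suc n) = w n" for n
    using d0[of n] upper_halfplane_minus_cnj_nonzero[OF orbit(1)[of n] orbit(1)[of "Suc n"]]
    by (auto simp: d_def pseudo_hyp_dist_def)
  then have "w n = w 0" for n by (induction n) auto
  then have "w \<longlonglongrightarrow> w 0"
    using tendsto_const[of "w 0" sequentially] by (simp add: tendsto_cong[of w "\<lambda>_. w 0"])
  then show False
    using not_tendsto_and_filterlim_at_infinity[OF sequentially_bot _ w_infinity] by blast
qed

lemma d_pos_eventually: "\<forall>\<^sub>F n in sequentially. d n > 0"
  using order_tendstoD(1)[OF d_lim a_pos] .

lemma a_sq_less_1: "a\<^sup>2 < 1"
  using a_pos a_less_1 by (simp add: abs_square_less_1)

lemma r_pos: "0 < r n"
  by (simp add: r_def Im_w_pos)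

lemma r_le_1: "r n \<le> 1"
  using Im_increasing[OF orbit(1)[of "Suc n"]] Im_w_pos[of n] by (simp add: r_def orbit(2))

lemma Im_w_antimono: "m \<le> n \<Longrightarrow> Im (w n) \<le> Im (w m)"
  by (rule lift_Suc_antimono_le) (use Im_increasing[OF orbit(1)[of "Suc _"]] in \<open>simp_all add: orbit(2)\<close>)

lemma D_eq: "4 * D n * r n = (s n)\<^sup>2 + (1 - r n)\<^sup>2"
proof -
  have "w (Suc n) - w n = of_real (Im (w n)) * Complex (s n) (r n - 1)"
    using Im_w_pos[of n] by (simp add: complex_eq_iff s_def r_def field_simps)
  then have "(norm (w (Suc n) - w n))\<^sup>2 = (Im (w n))\<^sup>2 * ((s n)\<^sup>2 + (1 - r n)\<^sup>2)"
    by (simp add: norm_mult power_mult_distrib cmod_power2 power2_commute)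
  moreover have "Im (w (Suc n)) = r n * Im (w n)"
    using Im_w_pos[of n] by (simp add: r_def)
  ultimately show ?thesis
    using Im_w_pos[of n] r_pos[of n] by (simp add: D_def sinh_sq_dist_def power2_eq_square)
qed

lemma D_eq_d: "D n = (d n)\<^sup>2 / (1 - (d n)\<^sup>2)"
  unfolding D_def d_def using sinh_sq_dist_eq orbit by simp

lemma d_sq_less_1: "(d n)\<^sup>2 < 1"
  using d_le_a[of n] d_nonneg[of n] a_less_1 by (simp add: abs_square_less_1)

text \<open>A form of \<open>D_eq\<close> with nonnegative terms on the left: dropping the term with
  \<open>s n\<close> bounds \<open>r n\<close> from below, and dropping
  \<open>(1 - r n)\<^sup>2\<close> bounds \<open>s n\<close>.\<close>

lemma step_identity: "(1 - (d n)\<^sup>2) * (s n)\<^sup>2 + (1 - r n)\<^sup>2 = (d n)\<^sup>2 * (1 + r n)\<^sup>2"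
proof -
  have "(1 - (d n)\<^sup>2) * ((s n)\<^sup>2 + (1 - r n)\<^sup>2) = 4 * (d n)\<^sup>2 * r n"
    unfolding D_eq[symmetric] D_eq_d using d_sq_less_1[of n] by simp
  then show ?thesis by (simp add: power2_eq_square algebra_simps)
qed

text \<open>The least imaginary part of a point at pseudo-hyperbolic distance at most
  \<open>a\<close> from \<i>.\<close>

definition \<kappa> :: real where "\<kappa> = (1 - a) / (1 + a)"

lemma \<kappa>_pos: "\<kappa> > 0"
  using a_pos a_less_1 by (simp add: \<kappa>_def)

lemma r_ge: "\<kappa> \<le> r n"
proof -
  have "0 \<le> (1 - (d n)\<^sup>2) * (s n)\<^sup>2" using d_sq_less_1[of n] by simp
  then have "(1 - r n)\<^sup>2 \<le> (d n * (1 + r n))\<^sup>2"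
    using step_identity[of n] by (simp add: power_mult_distrib)
  then have "1 - r n \<le> d n * (1 + r n)"
    by (rule power2_le_imp_le) (use d_nonneg[of n] r_pos[of n] in simp)
  also have "\<dots> \<le> a * (1 + r n)"
    using d_le_a[of n] r_pos[of n] by (intro mult_right_mono) auto
  finally show ?thesis using a_pos by (simp add: \<kappa>_def field_simps)
qed

lemma s_bounded: obtains B where "B > 0" "\<And>n. \<bar>s n\<bar> \<le> B"
proof -
  have "\<bar>s n\<bar> \<le> 2 / (1 - a\<^sup>2)" for n
  proof -
    have dn: "(d n)\<^sup>2 \<le> a\<^sup>2" using d_nonneg d_le_a by (intro power_mono)
    have "(1 - a\<^sup>2) * (s n)\<^sup>2 \<le> (1 - (d n)\<^sup>2) * (s n)\<^sup>2"
      using dn by (intro mult_right_mono) auto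
    also have "\<dots> \<le> (d n)\<^sup>2 * (1 + r n)\<^sup>2"
      using step_identity[of n] by (smt (verit) zero_le_power2)
    also have "\<dots> \<le> 1 * 2\<^sup>2"
      using d_sq_less_1[of n] r_le_1[of n] r_pos[of n] by (intro mult_mono power_mono) auto
    finally have le: "(1 - a\<^sup>2) * (s n)\<^sup>2 \<le> 4" by simp
    have "((1 - a\<^sup>2) * \<bar>s n\<bar>)\<^sup>2 = (1 - a\<^sup>2) * ((1 - a\<^sup>2) * (s n)\<^sup>2)"
      by (simp add: power2_eq_square)
    also have "\<dots> \<le> 1 * 4"
      using le a_sq_less_1 by (intro mult_mono) auto
    finally have "((1 - a\<^sup>2) * \<bar>s n\<bar>)\<^sup>2 \<le> 2\<^sup>2" by simp
    then have "(1 - a\<^sup>2) * \<bar>s n\<bar> \<le> 2" by (rule power2_le_imp_le) simp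
    then show ?thesis using a_sq_less_1 by (simp add: field_simps)
  qed
  moreover have "0 < 2 / (1 - a\<^sup>2)" using a_sq_less_1 by simp
  ultimately show ?thesis using that by blast
qed

lemma u_bounded: obtains B where "B > 0" "\<And>n. norm (u n) \<le> B"
proof -
  obtain B where B: "B > 0" "\<And>n. \<bar>s n\<bar> \<le> B" using s_bounded by blast
  have "norm (u n) \<le> B + 1" for n
    using cmod_le[of "u n"] B(2)[of n] r_le_1[of n] r_pos[of n] by (simp add: Re_u Im_u)
  then show ?thesis using that[of "B + 1"] B(1) by simp
qed

section \<open>The maps \<open>G\<close> and their rigidity\<close>

lemma funpow_orbit: "n \<le> m \<Longrightarrow> (\<phi> ^^ (m - n)) (w m) = w n"
proof (induction m)
  case (Suc m)
  show ?case
  proof (cases "n = Suc m")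
    case False
    then have "Suc m - n = Suc (m - n)" "n \<le> m" using Suc.prems by auto
    then show ?thesis using Suc.IH by (simp add: funpow_swap1 orbit(2))
  qed simp
qed simp

lemma G_self_map: "analytic_self_map (G n m)"
  unfolding G_def
  by (intro analytic_self_map_compose analytic_self_map_tau analytic_self_map_tau_inv
      analytic_self_map_funpow self_map orbit)

lemma G_ii: "n \<le> m \<Longrightarrow> G n m \<i> = \<i>"
  by (simp add: G_def tau_ii funpow_orbit tau_inv_self orbit)

lemma G_u: "n \<le> m \<Longrightarrow> G n m (u m) = u n"
proof -
  assume "n \<le> m"
  then have "(\<phi> ^^ (m - n)) (w (Suc m)) = w (Suc n)"
    using funpow_orbit[of "Suc n" "Suc m"] by simp
  then show ?thesis by (simp add: G_def u_def tau_tau_inv orbit)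
qed

text \<open>Schwarz-Pick is nearly sharp at \<open>u m\<close>: its distance from \<i> is
  \<open>d m\<close>, that of its image \<open>u n\<close> is \<open>d n\<close>, and both are close
  to \<open>a\<close> for large indices.\<close>

lemma G_rigid:
  assumes "n \<le> m" "d m > 0" and z: "z \<in> upper_halfplane" "z \<noteq> \<i>"
  shows "(norm (cayley (G n m z) / cayley z - cayley (u n) / cayley (u m)))\<^sup>2
           * (1 - (pseudo_hyp_dist (u m) z)\<^sup>2) \<le> 1 - (d n / d m)\<^sup>2"
proof -
  have "u m \<noteq> \<i>" using assms(2) norm_cayley_u[of m] by (auto simp: cayley_def)
  from halfplane_rigidity[OF G_self_map G_ii[OF assms(1)] z u_in this] show ?thesis
    by (simp add: G_u assms(1) norm_cayley_u flip: norm_cayley)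
qed

text \<open>The points \<open>u m\<close> are bounded and have imaginary part at least
  \<open>\<kappa>\<close>, so their distances to a compact set stay away from 1. This makes the
  weight in \<open>G_rigid\<close> harmless, uniformly in \<open>m\<close>.\<close>

lemma dist_u_uniform:
  assumes K: "compact K" "K \<subseteq> upper_halfplane"
  obtains \<delta> where "\<delta> > 0" "\<And>m z. z \<in> K \<Longrightarrow> \<delta> \<le> 1 - (pseudo_hyp_dist (u m) z)\<^sup>2"
proof (cases "K = {}")
  case False
  obtain B where B: "B > 0" "\<And>n. norm (u n) \<le> B" using u_bounded by blast
  obtain R where R: "\<And>z. z \<in> K \<Longrightarrow> norm z \<le> R"
    using compact_imp_bounded[OF K(1)] by (auto simp: bounded_iff)
  obtain z0 where z0: "z0 \<in> K" "\<And>z. z \<in> K \<Longrightarrow> Im z0 \<le> Im z"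
    using continuous_attains_inf[OF K(1) False continuous_on_Im[OF continuous_on_id]] by auto
  have z0p: "Im z0 > 0" using z0(1) K(2) by (auto simp: upper_halfplane_def)
  have R0: "R \<ge> 0" using R[OF z0(1)] norm_ge_zero order_trans by blast
  have "4 * \<kappa> * Im z0 / (R + B)\<^sup>2 \<le> 1 - (pseudo_hyp_dist (u m) z)\<^sup>2" if z: "z \<in> K" for m z
  proof -
    have zH: "z \<in> upper_halfplane" using z K by auto
    have "norm (z - cnj (u m)) \<le> R + B"
      using norm_triangle_ineq4[of z "cnj (u m)"] R[OF z] B(2)[of m] by simp
    moreover have "0 < norm (z - cnj (u m))"
      using upper_halfplane_minus_cnj_nonzero[OF u_in zH] by simp
    moreover have "4 * \<kappa> * Im z0 \<le> 4 * r m * Im z"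
      using r_ge[of m] z0(2)[OF z] \<kappa>_pos z0p r_pos[of m] by (intro mult_mono) auto
    moreover have "0 \<le> 4 * r m * Im z" using r_pos[of m] zH by (simp add: upper_halfplane_def)
    moreover have "0 < 4 * \<kappa> * Im z0" using \<kappa>_pos z0p by simp
    ultimately show ?thesis
      unfolding one_minus_pseudo_hyp_dist_sq[OF u_in zH] Im_u
      by (intro frac_le power_mono zero_less_power) auto
  qed
  moreover have "0 < 4 * \<kappa> * Im z0 / (R + B)\<^sup>2"
    using \<kappa>_pos z0p B R0 by simp
  ultimately show ?thesis using that by blast
qed (use that[of 1] in auto)

lemma d_ratio_lim: "(\<lambda>n. 1 - (d n / d (Suc n))\<^sup>2) \<longlonglongrightarrow> 0"
proof -
  have "(\<lambda>n. 1 - (d n / d (Suc n))\<^sup>2) \<longlonglongrightarrow> 1 - (a / a)\<^sup>2"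
    using a_pos by (intro tendsto_intros d_lim LIMSEQ_Suc[OF d_lim]) auto
  then show ?thesis using a_pos by simp
qed

text \<open>By rigidity, \<open>G n (Suc n)\<close> is close to the rotation about \<open>\<i>\<close> by the factor
  \<open>\<lambda> = cayley (u n) / cayley (u (Suc n))\<close>. Since it contracts imaginary parts at most by \<open>\<kappa>\<close>,
  it moves \<open>\<i>T\<close> close to \<open>\<infinity>\<close> for large \<open>T\<close>, which forces \<open>\<lambda>\<close> to be close to \<open>1\<close>.\<close>
lemma rotation_lim: "(\<lambda>n. cayley (u n) / cayley (u (Suc n))) \<longlonglongrightarrow> 1"
proof (rule tendstoI)
  fix e :: real assume e: "e > 0"
  define lam where "lam n = cayley (u n) / cayley (u (Suc n))" for n
  \<comment> \<open>The first summand will bound the distance of \<open>cayley \<zeta>\<close> from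
    1, the second the effect of dividing by \<open>cayley p\<close>; the other half of
    \<open>e\<close> is left for the rigidity estimate.\<close>
  have lim: "((\<lambda>T. 2 / (\<kappa> * T) + 2 / (T - 1)) \<longlongrightarrow> 0) at_top"
    using \<kappa>_pos by real_asymp
  have "\<forall>\<^sub>F T in at_top. 2 / (\<kappa> * T) + 2 / (T - 1) < e / 2 \<and> T > 1"
    using e by (intro eventually_conj order_tendstoD(2)[OF lim] eventually_gt_at_top) auto
  then obtain T where T: "2 / (\<kappa> * T) + 2 / (T - 1) < e / 2" "T > 1"
    using eventually_happens by force
  define p where "p = \<i> * complex_of_real T"
  have pH: "p \<in> upper_halfplane" "p \<noteq> \<i>"
    using T by (auto simp: p_def upper_halfplane_def complex_eq_iff)
  have cp: "cayley p = of_real ((T - 1) / (T + 1))"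
  proof -
    have "p - \<i> = \<i> * of_real (T - 1)" "p + \<i> = \<i> * of_real (T + 1)"
      by (simp_all add: p_def algebra_simps)
    then show ?thesis unfolding cayley_def by simp
  qed
  obtain \<delta> where \<delta>: "\<delta> > 0" "\<And>m. \<delta> \<le> 1 - (pseudo_hyp_dist (u m) p)\<^sup>2"
    using dist_u_uniform[of "{p}"] pH by auto
  have "\<forall>\<^sub>F n in sequentially. 1 - (d n / d (Suc n))\<^sup>2 < (e / 2)\<^sup>2 * \<delta>"
    using order_tendstoD(2)[OF d_ratio_lim] e \<delta> by simp
  then show "\<forall>\<^sub>F n in sequentially. dist (cayley (u n) / cayley (u (Suc n))) 1 < e"
    using d_pos_eventually
  proof eventually_elim
    case (elim n)
    then have dpos: "d (Suc n) > 0" using d_mono[of n "Suc n"] by simp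
    define \<zeta> where "\<zeta> = G n (Suc n) p"
    have \<zeta>H: "\<zeta> \<in> upper_halfplane"
      unfolding \<zeta>_def using analytic_self_map_in[OF G_self_map] pH by blast
    have "(norm (cayley \<zeta> / cayley p - lam n))\<^sup>2 * \<delta>
        \<le> (norm (cayley \<zeta> / cayley p - lam n))\<^sup>2 * (1 - (pseudo_hyp_dist (u (Suc n)) p)\<^sup>2)"
      using \<delta>(2) by (intro mult_left_mono) auto
    also have "\<dots> < (e / 2)\<^sup>2 * \<delta>"
      using G_rigid[OF _ dpos pH, of n] elim(1) unfolding \<zeta>_def lam_def by simp
    finally have "(norm (cayley \<zeta> / cayley p - lam n))\<^sup>2 < (e / 2)\<^sup>2" using \<delta>(1) by simp
    then have 1: "norm (cayley \<zeta> / cayley p - lam n) < e / 2"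
      by (rule power2_less_imp_less) (use e in simp)
    \<comment> \<open>The two normalizations together scale imaginary parts by \<open>r n\<close>,
      and \<open>\<phi>\<close> between them does not decrease them. So the image of
      \<open>p\<close> is still high.\<close>
    have "\<kappa> * T \<le> r n * T" using r_ge[of n] T by (intro mult_right_mono) auto
    also have "\<dots> = Im (tau (w (Suc n)) p) / Im (w n)"
      by (simp add: Im_tau r_def p_def)
    also have "\<dots> \<le> Im (\<phi> (tau (w (Suc n)) p)) / Im (w n)"
      using Im_increasing analytic_self_map_in[OF analytic_self_map_tau] orbit pH Im_w_pos[of n]
      by (intro divide_right_mono) auto
    also have "\<dots> = Im \<zeta>" by (simp add: \<zeta>_def G_def Im_tau_inv)
    finally have "\<kappa> * T \<le> \<bar>Im (\<zeta> + \<i>)\<bar>" by simp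
    then have "\<kappa> * T \<le> norm (\<zeta> + \<i>)" using abs_Im_le_cmod order_trans by blast
    moreover have "1 - cayley \<zeta> = 2 * \<i> / (\<zeta> + \<i>)"
      using upper_halfplane_plus_ii_nonzero[OF \<zeta>H] by (simp add: cayley_def field_simps)
    ultimately have 2: "norm (1 - cayley \<zeta>) \<le> 2 / (\<kappa> * T)"
      using \<kappa>_pos T by (simp add: norm_divide norm_mult frac_le)
    have "cayley \<zeta> / cayley p - cayley \<zeta> = cayley \<zeta> * of_real (1 / ((T - 1) / (T + 1)) - 1)"
      unfolding cp by (simp add: right_diff_distrib)
    moreover have "1 / ((T - 1) / (T + 1)) - 1 = 2 / (T - 1)" using T by (simp add: field_simps)
    ultimately have "cayley \<zeta> / cayley p - cayley \<zeta> = cayley \<zeta> * of_real (2 / (T - 1))" by (simp only:)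
    then have "norm (cayley \<zeta> / cayley p - cayley \<zeta>) = norm (cayley \<zeta>) * (2 / (T - 1))"
      using T by (simp only: norm_mult norm_of_real) simp
    also have "\<dots> \<le> 1 * (2 / (T - 1))"
      using norm_cayley_less_1[OF \<zeta>H] T by (intro mult_right_mono) auto
    finally have 3: "norm (cayley \<zeta> / cayley p - cayley \<zeta>) \<le> 2 / (T - 1)" by simp
    have "norm (lam n - 1) \<le> norm (cayley \<zeta> / cayley p - lam n)
        + norm (cayley \<zeta> / cayley p - cayley \<zeta>) + norm (1 - cayley \<zeta>)"
      using norm_triangle_ineq4[of "cayley \<zeta> / cayley p - cayley \<zeta> - (1 - cayley \<zeta>)" "cayley \<zeta> / cayley p - lam n"]
        norm_triangle_ineq4[of "cayley \<zeta> / cayley p - cayley \<zeta>" "1 - cayley \<zeta>"]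
      by simp
    also have "\<dots> < e" using 1 2 3 T by simp
    finally show ?case by (simp add: lam_def dist_norm)
  qed
qed

text \<open>A ratio close to 1 makes the Cayley images close, and the inverse Cayley transform is
  Lipschitz on the images of a bounded set; the constant is
  \<open>(B + 1)\<^sup>2 / 2\<close>.\<close>

lemma u_diff_lim: "(\<lambda>n. u (Suc n) - u n) \<longlonglongrightarrow> 0"
proof -
  obtain B where B: "B > 0" "\<And>n. norm (u n) \<le> B" using u_bounded by blast
  have "(\<lambda>n. cayley (u n) / cayley (u (Suc n)) - 1) \<longlonglongrightarrow> 0"
    using tendsto_diff[OF rotation_lim tendsto_const[of 1]] by simp
  then have lim: "(\<lambda>n. norm (cayley (u n) / cayley (u (Suc n)) - 1) * ((B + 1)\<^sup>2 / 2)) \<longlonglongrightarrow> 0"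
    by (intro tendsto_mult_left_zero tendsto_norm_zero)
  show ?thesis
  proof (rule Lim_null_comparison[OF _ lim])
    show "\<forall>\<^sub>F n in sequentially. norm (u (Suc n) - u n)
            \<le> norm (cayley (u n) / cayley (u (Suc n)) - 1) * ((B + 1)\<^sup>2 / 2)"
      using d_pos_eventually
    proof eventually_elim
      case (elim n)
      let ?v = "u (Suc n)"
      have nz: "u n + \<i> \<noteq> 0" "?v + \<i> \<noteq> 0" using upper_halfplane_plus_ii_nonzero u_in by auto
      have "cayley ?v \<noteq> 0"
        using elim d_mono[of n "Suc n"] norm_cayley_u[of "Suc n"] by auto
      then have "norm (cayley (u n) - cayley ?v) = norm (cayley (u n) / cayley ?v - 1) * norm (cayley ?v)"
        by (simp add: divide_simps flip: norm_mult)
      also have "\<dots> \<le> norm (cayley (u n) / cayley ?v - 1)"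
        using norm_cayley_less_1[OF u_in] by (simp add: mult_left_le less_imp_le)
      finally have 1: "norm (cayley (u n) - cayley ?v) \<le> norm (cayley (u n) / cayley ?v - 1)" .
      have "?v - u n = (cayley (u n) - cayley ?v) * (\<i> * (u n + \<i>) * (?v + \<i>) / 2)"
        using nz by (simp add: cayley_def divide_simps) (simp add: algebra_simps)
      then have "norm (?v - u n) = norm (cayley (u n) - cayley ?v) * (norm (u n + \<i>) * norm (?v + \<i>) / 2)"
        by (simp only: norm_mult norm_divide) simp
      also have "\<dots> \<le> norm (cayley (u n) / cayley ?v - 1) * ((B + 1) * (B + 1) / 2)"
      proof -
        have "norm (u k + \<i>) \<le> B + 1" for k
          using norm_triangle_ineq[of "u k" \<i>] B(2)[of k] by simp
        then show ?thesis using 1 B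
          by (intro mult_mono divide_right_mono) auto
      qed
      finally show ?case by (simp add: power2_eq_square)
    qed
  qed
qed

lemma s_diff_lim: "(\<lambda>n. s (Suc n) - s n) \<longlonglongrightarrow> 0" and r_diff_lim: "(\<lambda>n. r (Suc n) - r n) \<longlonglongrightarrow> 0"
  using tendsto_Re[OF u_diff_lim] tendsto_Im[OF u_diff_lim] by (simp_all add: Re_u Im_u)

section \<open>Two-step distances and the limit of \<open>r\<close>\<close>

definition Q :: "nat \<Rightarrow> real" where
  "Q n = sinh_sq_dist (w n) (w (Suc (Suc n)))"

lemma D_lim: "D \<longlonglongrightarrow> a\<^sup>2 / (1 - a\<^sup>2)"
  unfolding D_eq_d
  using a_sq_less_1 by (intro tendsto_intros d_lim) auto

lemma Q_eq: "4 * Q n * (r n * r (Suc n)) = (s n + r n * s (Suc n))\<^sup>2 + (1 - r n * r (Suc n))\<^sup>2"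
proof -
  let ?v = "w (Suc (Suc n))"
  have y: "Im ?v = Im (w n) * (r n * r (Suc n))"
    using Im_w_pos[of n] Im_w_pos[of "Suc n"] by (simp add: r_def)
  have "Re (w (Suc n)) - Re (w n) = Im (w n) * s n"
    using Im_w_pos[of n] by (simp add: s_def)
  moreover have "Re ?v - Re (w (Suc n)) = Im (w n) * (r n * s (Suc n))"
    using Im_w_pos[of n] Im_w_pos[of "Suc n"] by (simp add: s_def r_def)
  ultimately have "?v - w n = of_real (Im (w n)) * Complex (s n + r n * s (Suc n)) (r n * r (Suc n) - 1)"
    using y by (simp add: complex_eq_iff algebra_simps)
  then have "(norm (?v - w n))\<^sup>2
      = (Im (w n))\<^sup>2 * ((s n + r n * s (Suc n))\<^sup>2 + (1 - r n * r (Suc n))\<^sup>2)"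
    by (simp add: norm_mult power_mult_distrib cmod_power2 power2_commute)
  then show ?thesis
    using Im_w_pos[of n] r_pos[of n] r_pos[of "Suc n"]
    by (simp add: Q_def sinh_sq_dist_def y power2_eq_square)
qed

text \<open>\<open>\<phi>\<close> maps each pair two steps apart to the preceding such pair and
  contracts distances, so \<open>Q\<close> increases; the bounds on \<open>r\<close> and
  \<open>s\<close> keep it bounded.\<close>

lemma Q_convergent: "convergent Q"
proof (rule Bseq_monoseq_convergent)
  have "incseq Q"
    unfolding incseq_Suc_iff Q_def
    using sinh_sq_dist_mono[OF self_map orbit(1) orbit(1)] by (metis orbit(2))
  then show "monoseq Q" by (rule incseq_imp_monoseq)
  obtain B where B: "B > 0" "\<And>n. \<bar>s n\<bar> \<le> B" using s_bounded by blast
  have "norm (Q n) \<le> ((2 * B)\<^sup>2 + 1\<^sup>2) / (4 * \<kappa>\<^sup>2)" for n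
  proof -
    have rr: "\<kappa>\<^sup>2 \<le> r n * r (Suc n)" "r n * r (Suc n) \<le> 1"
      using r_ge[of n] r_ge[of "Suc n"] r_le_1[of n] r_le_1[of "Suc n"] r_pos[of n] r_pos[of "Suc n"] \<kappa>_pos
      by (auto simp: power2_eq_square intro!: mult_mono mult_le_one)
    have "\<bar>r n * s (Suc n)\<bar> \<le> 1 * B"
      unfolding abs_mult using r_le_1[of n] r_pos[of n] B by (intro mult_mono) auto
    then have "\<bar>s n + r n * s (Suc n)\<bar> \<le> 2 * B" using B(2)[of n] by linarith
    then have "(s n + r n * s (Suc n))\<^sup>2 \<le> (2 * B)\<^sup>2"
      by (metis abs_ge_zero power2_abs power_mono)
    moreover have "(1 - r n * r (Suc n))\<^sup>2 \<le> 1\<^sup>2"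
      using rr r_pos[of n] r_pos[of "Suc n"] by (intro power_mono) auto
    ultimately have num: "4 * Q n * (r n * r (Suc n)) \<le> (2 * B)\<^sup>2 + 1\<^sup>2"
      unfolding Q_eq by (rule add_mono)
    have "0 \<le> Q n" unfolding Q_def sinh_sq_dist_def using Im_w_pos by (simp add: less_imp_le)
    then have "4 * Q n * \<kappa>\<^sup>2 \<le> 4 * Q n * (r n * r (Suc n))"
      using rr by (intro mult_left_mono) auto
    then have "Q n * (4 * \<kappa>\<^sup>2) \<le> (2 * B)\<^sup>2 + 1\<^sup>2" using num by simp
    then show ?thesis
      using \<kappa>_pos \<open>0 \<le> Q n\<close> by (subst pos_le_divide_eq) auto
  qed
  then show "Bseq Q" by (rule BseqI')
qed

text \<open>If two consecutive steps were equal, then \<open>Q n = D n * (1 + r n)\<^sup>2 / r n\<close>, an expression that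
  determines \<open>r n\<close>: the monotone quantities \<open>D\<close> and \<open>Q\<close> give the trace of \<open>z \<mapsto> s n + r n * z\<close>.\<close>
lemma r_convergent: "convergent r"
proof -
  obtain B where B: "B > 0" "\<And>n. \<bar>s n\<bar> \<le> B" using s_bounded by blast
  obtain L where L: "Q \<longlonglongrightarrow> L" using Q_convergent by (auto simp: convergent_def)
  define \<epsilon> where "\<epsilon> n = s (Suc n) - s n" for n
  define \<delta> where "\<delta> n = r (Suc n) - r n" for n
  have lims: "\<epsilon> \<longlonglongrightarrow> 0" "\<delta> \<longlonglongrightarrow> 0"
    using s_diff_lim r_diff_lim by (simp_all add: \<epsilon>_def[abs_def] \<delta>_def[abs_def])
  \<comment> \<open>The exact error of treating two consecutive steps as equal: every term of the
    numerator carries a factor \<open>\<epsilon> n\<close> or \<open>\<delta> n\<close>.\<close>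
  have diff: "Q n - D n * ((1 + r n)\<^sup>2 / r n)
      = (\<epsilon> n * (2 * s n * (1 + r n) + r n * \<epsilon> n) - \<delta> n * (2 * (1 - (r n)\<^sup>2) - r n * \<delta> n) - 4 * \<delta> n * Q n) / (4 * r n)"
    for n
  proof -
    have 1: "4 * Q n * (r n * (r n + \<delta> n)) = (s n + r n * (s n + \<epsilon> n))\<^sup>2 + (1 - r n * (r n + \<delta> n))\<^sup>2"
      using Q_eq[of n] by (simp add: \<epsilon>_def \<delta>_def)
    have 2: "4 * D n * r n * (1 + r n)\<^sup>2 = ((s n)\<^sup>2 + (1 - r n)\<^sup>2) * (1 + r n)\<^sup>2"
      using D_eq[of n] by simp
    have "(Q n * r n - D n * (1 + r n)\<^sup>2) * (4 * r n)
        = (\<epsilon> n * (2 * s n * (1 + r n) + r n * \<epsilon> n) - \<delta> n * (2 * (1 - (r n)\<^sup>2) - r n * \<delta> n) - 4 * \<delta> n * Q n) * r n"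
      using 1 2 by algebra
    then show ?thesis using r_pos[of n] by (simp add: field_simps)
  qed
  have "(\<lambda>n. Q n - D n * ((1 + r n)\<^sup>2 / r n)) \<longlonglongrightarrow> 0"
  proof (rule Lim_null_comparison)
    show "\<forall>\<^sub>F n in sequentially. norm (Q n - D n * ((1 + r n)\<^sup>2 / r n))
        \<le> (\<bar>\<epsilon> n\<bar> * (4 * B + \<bar>\<epsilon> n\<bar>) + \<bar>\<delta> n\<bar> * (2 + \<bar>\<delta> n\<bar>) + 4 * \<bar>\<delta> n\<bar> * \<bar>Q n\<bar>) / (4 * \<kappa>)"
    proof (intro always_eventually allI)
      fix n
      have r: "0 < r n" "r n \<le> 1" using r_pos r_le_1 by auto
      have sB: "\<bar>s n * (1 + r n)\<bar> \<le> B * 2"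
        unfolding abs_mult using r B by (intro mult_mono) auto
      have re: "\<bar>r n * x\<bar> \<le> \<bar>x\<bar>" for x
        unfolding abs_mult using r mult_right_mono[of "r n" 1 "\<bar>x\<bar>"] by simp
      have "\<bar>2 * s n * (1 + r n) + r n * \<epsilon> n\<bar> \<le> 4 * B + \<bar>\<epsilon> n\<bar>"
        using sB re[of "\<epsilon> n"] by (simp add: mult.assoc)
      then have 1: "\<bar>\<epsilon> n * (2 * s n * (1 + r n) + r n * \<epsilon> n)\<bar> \<le> \<bar>\<epsilon> n\<bar> * (4 * B + \<bar>\<epsilon> n\<bar>)"
        unfolding abs_mult by (intro mult_left_mono) auto
      have "(r n)\<^sup>2 \<le> 1" using r by (simp add: power_le_one)
      then have "\<bar>2 * (1 - (r n)\<^sup>2) - r n * \<delta> n\<bar> \<le> 2 + \<bar>\<delta> n\<bar>"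
        using re[of "\<delta> n"] by (intro order_trans[OF abs_triangle_ineq4] add_mono) auto
      then have 2: "\<bar>\<delta> n * (2 * (1 - (r n)\<^sup>2) - r n * \<delta> n)\<bar> \<le> \<bar>\<delta> n\<bar> * (2 + \<bar>\<delta> n\<bar>)"
        unfolding abs_mult by (intro mult_left_mono) auto
      have "\<bar>\<epsilon> n * (2 * s n * (1 + r n) + r n * \<epsilon> n) - \<delta> n * (2 * (1 - (r n)\<^sup>2) - r n * \<delta> n) - 4 * \<delta> n * Q n\<bar>
          \<le> \<bar>\<epsilon> n\<bar> * (4 * B + \<bar>\<epsilon> n\<bar>) + \<bar>\<delta> n\<bar> * (2 + \<bar>\<delta> n\<bar>) + \<bar>4 * \<delta> n * Q n\<bar>"
        using 1 2 by linarith
      then show "norm (Q n - D n * ((1 + r n)\<^sup>2 / r n))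
        \<le> (\<bar>\<epsilon> n\<bar> * (4 * B + \<bar>\<epsilon> n\<bar>) + \<bar>\<delta> n\<bar> * (2 + \<bar>\<delta> n\<bar>) + 4 * \<bar>\<delta> n\<bar> * \<bar>Q n\<bar>) / (4 * \<kappa>)"
        unfolding diff real_norm_def abs_divide using r_ge[of n] r \<kappa>_pos B(1)
        by (intro frac_le) (auto simp: abs_mult intro!: add_nonneg_nonneg mult_nonneg_nonneg)
    qed
    have "(\<lambda>n. (\<bar>\<epsilon> n\<bar> * (4 * B + \<bar>\<epsilon> n\<bar>) + \<bar>\<delta> n\<bar> * (2 + \<bar>\<delta> n\<bar>) + 4 * \<bar>\<delta> n\<bar> * \<bar>Q n\<bar>) / (4 * \<kappa>))
       \<longlonglongrightarrow> (\<bar>0\<bar> * (4 * B + \<bar>0\<bar>) + \<bar>0\<bar> * (2 + \<bar>0\<bar>) + 4 * \<bar>0\<bar> * \<bar>L\<bar>) / (4 * \<kappa>)"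
      using \<kappa>_pos by (intro tendsto_intros lims L) auto
    then show "(\<lambda>n. (\<bar>\<epsilon> n\<bar> * (4 * B + \<bar>\<epsilon> n\<bar>) + \<bar>\<delta> n\<bar> * (2 + \<bar>\<delta> n\<bar>) + 4 * \<bar>\<delta> n\<bar> * \<bar>Q n\<bar>) / (4 * \<kappa>)) \<longlonglongrightarrow> 0"
      by simp
  qed
  from tendsto_diff[OF L this] have lim: "(\<lambda>n. D n * ((1 + r n)\<^sup>2 / r n)) \<longlonglongrightarrow> L" by simp
  define A where "A = a\<^sup>2 / (1 - a\<^sup>2)"
  have A: "A > 0" using a_pos a_sq_less_1 by (simp add: A_def)
  have "(\<lambda>n. D n * ((1 + r n)\<^sup>2 / r n) / D n - 2) \<longlonglongrightarrow> L / A - 2"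
    using A by (intro tendsto_intros lim D_lim[folded A_def]) auto
  moreover have "\<forall>\<^sub>F n in sequentially. D n * ((1 + r n)\<^sup>2 / r n) / D n - 2 = r n + 1 / r n"
    using order_tendstoD(1)[OF D_lim A[unfolded A_def]]
  proof eventually_elim
    case (elim n)
    then show ?case using r_pos[of n] by (simp add: divide_simps) (simp add: power2_eq_square algebra_simps)
  qed
  ultimately have X: "(\<lambda>n. r n + 1 / r n) \<longlonglongrightarrow> L / A - 2"
    using tendsto_cong by fast
  \<comment> \<open>\<open>r n\<close> and its inverse are the roots of a quadratic with constant
    term 1; since \<open>r n\<close> is at most 1, it is the smaller root, hence a continuous
    function of their sum.\<close>
  have "r n = ((r n + 1 / r n) - sqrt ((r n + 1 / r n)\<^sup>2 - 4)) / 2" for n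
  proof -
    have "(r n + 1 / r n)\<^sup>2 - 4 = (1 / r n - r n)\<^sup>2"
      using r_pos[of n] by (simp add: power2_eq_square field_simps)
    moreover have "1 / r n \<ge> r n"
      using r_pos[of n] r_le_1[of n] by (simp add: pos_le_divide_eq mult_le_one)
    ultimately show ?thesis by simp
  qed
  then have "r = (\<lambda>n. ((r n + 1 / r n) - sqrt ((r n + 1 / r n)\<^sup>2 - 4)) / 2)" by blast
  moreover have "\<dots> \<longlonglongrightarrow> ((L / A - 2) - sqrt ((L / A - 2)\<^sup>2 - 4)) / 2"
    by (intro tendsto_intros X) auto
  ultimately show ?thesis unfolding convergent_def by metis
qed

text \<open>A limit less than \<open>1\<close> would make \<open>Im \<circ> w\<close> decay geometrically, so that \<open>w\<close> would converge.\<close>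
lemma r_lim: "r \<longlonglongrightarrow> 1"
proof -
  obtain c where c: "r \<longlonglongrightarrow> c" using r_convergent by (auto simp: convergent_def)
  have "c \<le> 1" using r_le_1 by (intro LIMSEQ_le_const2[OF c]) auto
  have "\<not> c < 1"
  proof
    assume "c < 1"
    then obtain q where q: "c < q" "q < 1" using dense by blast
    obtain N where N: "\<And>n. n \<ge> N \<Longrightarrow> r n < q"
      using order_tendstoD(2)[OF c q(1)] by (auto simp: eventually_sequentially)
    obtain B where B: "B > 0" "\<And>n. norm (u n) \<le> B" using u_bounded by blast
    have "summable (\<lambda>n. Im (w n))"
    proof (rule summable_ratio_test[OF q(2)])
      fix n assume "N \<le> n"
      then show "norm (Im (w (Suc n))) \<le> q * norm (Im (w n))"
        using N[of n] Im_w_pos[of n] Im_w_pos[of "Suc n"] by (simp add: r_def pos_divide_less_eq)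
    qed
    then have "summable (\<lambda>n. Im (w n) * (B + 1))" by (rule summable_mult2)
    then have "summable (\<lambda>n. w (Suc n) - w n)"
    proof (rule summable_comparison_test'[where N = 0])
      fix n
      have "w (Suc n) - w n = of_real (Im (w n)) * (u n - \<i>)"
        using Im_w_pos[of n] by (simp add: complex_eq_iff Re_u Im_u s_def r_def field_simps)
      then have "norm (w (Suc n) - w n) = Im (w n) * norm (u n - \<i>)"
        using Im_w_pos[of n] by (simp add: norm_mult)
      also have "\<dots> \<le> Im (w n) * (B + 1)"
        using norm_triangle_ineq4[of "u n" \<i>] B(2)[of n] Im_w_pos[of n]
        by (intro mult_left_mono) auto
      finally show "norm (w (Suc n) - w n) \<le> Im (w n) * (B + 1)" .
    qed
    then have "(\<lambda>n. (\<Sum>k<n. w (Suc k) - w k)) \<longlonglongrightarrow> (\<Sum>k. w (Suc k) - w k)"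
      by (rule summable_LIMSEQ)
    then have "(\<lambda>n. w n - w 0) \<longlonglongrightarrow> (\<Sum>k. w (Suc k) - w k)"
      by (simp add: sum_lessThan_telescope)
    from tendsto_add[OF this tendsto_const[of "w 0"]]
    have "w \<longlonglongrightarrow> (\<Sum>k. w (Suc k) - w k) + w 0" by simp
    then show False
      using not_tendsto_and_filterlim_at_infinity[OF sequentially_bot _ w_infinity] by blast
  qed
  then show ?thesis using c \<open>c \<le> 1\<close> by simp
qed

section \<open>The limit of \<open>s\<close>\<close>

definition b :: real where "b = 2 * a / sqrt (1 - a\<^sup>2)"

lemma b_pos: "b > 0"
  using a_pos a_sq_less_1 by (simp add: b_def)

text \<open>\<open>D_eq\<close> is solved for the square of \<open>s n\<close>, so the sign remains
  undetermined.\<close>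

lemma abs_s_lim: "(\<lambda>n. \<bar>s n\<bar>) \<longlonglongrightarrow> b"
proof -
  have "(\<lambda>n. sqrt (4 * D n * r n - (1 - r n)\<^sup>2)) \<longlonglongrightarrow> sqrt (4 * (a\<^sup>2 / (1 - a\<^sup>2)) * 1 - (1 - 1)\<^sup>2)"
    by (intro tendsto_intros D_lim r_lim)
  moreover have "sqrt (4 * (a\<^sup>2 / (1 - a\<^sup>2)) * 1 - (1 - 1)\<^sup>2) = b"
    using a_pos by (simp add: b_def real_sqrt_divide real_sqrt_mult)
  ultimately show ?thesis unfolding D_eq by simp
qed

text \<open>The hypothesis on the argument enters here: it excludes an approach to infinity along
  the negative real direction.\<close>

lemma Re_w_pos_eventually: "\<forall>\<^sub>F n in sequentially. Re (w n) > 0"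
proof -
  have "\<forall>\<^sub>F n in sequentially. \<bar>Arg (w n)\<bar> < pi / 2"
    using order_tendstoD(2)[OF tendsto_rabs_zero[OF Arg_lim], of "pi / 2"] by simp
  then show ?thesis
  proof eventually_elim
    case (elim n)
    then show ?case using Im_w_pos[of n] Arg_Re_pos[of "w n"] by auto
  qed
qed

text \<open>The sign of \<open>s\<close> is eventually constant, and it is not negative because
  otherwise \<open>w\<close> would stay bounded.\<close>
lemma s_lim: "s \<longlonglongrightarrow> b"
proof -
  have "\<forall>\<^sub>F n in sequentially. \<bar>s n\<bar> > b / 2 \<and> \<bar>s (Suc n) - s n\<bar> < b / 2 \<and> Re (w n) > 0"
    using b_pos
    by (intro eventually_conj order_tendstoD(1)[OF abs_s_lim]
        order_tendstoD(2)[OF tendsto_rabs_zero[OF s_diff_lim]] Re_w_pos_eventually) auto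
  then obtain N where N: "\<And>n. n \<ge> N \<Longrightarrow> \<bar>s n\<bar> > b / 2"
      "\<And>n. n \<ge> N \<Longrightarrow> \<bar>s (Suc n) - s n\<bar> < b / 2" "\<And>n. n \<ge> N \<Longrightarrow> Re (w n) > 0"
    unfolding eventually_sequentially by blast
  \<comment> \<open>A change of sign would need an increment larger than \<open>b\<close>, while
    increments are below \<open>b / 2\<close>.\<close>
  have sgn: "s (Suc n) > 0 \<longleftrightarrow> s n > 0" if "n \<ge> N" for n
    using N(1,2)[OF that] N(1)[of "Suc n"] that by linarith
  have pos: "s N > 0"
  proof (rule ccontr)
    assume nonpos: "\<not> s N > 0"
    have neg: "s n \<le> 0" if "n \<ge> N" for n
      using that by (induction n rule: dec_induct) (use nonpos sgn not_less in auto)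
    have "Re (w n) \<le> Re (w N)" if "n \<ge> N" for n
      using that
    proof (induction n rule: dec_induct)
      case (step n)
      then show ?case using neg[of n] Im_w_pos[of n] by (simp add: s_def divide_le_0_iff)
    qed simp
    \<comment> \<open>The real part is trapped between 0 and \<open>Re (w N)\<close>, and the
      imaginary part never exceeds its initial value.\<close>
    then have "norm (w n) \<le> Re (w N) + Im (w 0)" if "n \<ge> N" for n
      using cmod_le[of "w n"] N(3)[OF that] Im_w_pos[of n] Im_w_antimono[of 0 n] that by fastforce
    moreover have "\<forall>\<^sub>F n in sequentially. Re (w N) + Im (w 0) < norm (w n)"
      using w_infinity by (simp add: filterlim_at_infinity_conv_norm_at_top filterlim_at_top_dense)
    ultimately show False
      unfolding eventually_sequentially by (meson leD nle_le)
  qed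
  have "s n > 0" if "n \<ge> N" for n
    using that by (induction n rule: dec_induct) (use pos sgn in auto)
  then have "\<forall>\<^sub>F n in sequentially. \<bar>s n\<bar> = s n"
    unfolding eventually_sequentially by (intro exI[of _ N]) (auto simp: less_imp_le)
  from tendsto_cong[OF this] show ?thesis using abs_s_lim by blast
qed

lemma u_lim: "u \<longlonglongrightarrow> Complex b 1"
  using tendsto_Complex[OF s_lim r_lim] by (simp flip: Re_u Im_u)

section \<open>Convergence of the normalized iterates\<close>

definition F :: "nat \<Rightarrow> complex \<Rightarrow> complex" where
  "F n = (\<phi> ^^ n) \<circ> tau (w n)"

definition \<psi> :: "complex \<Rightarrow> complex" where
  "\<psi> z = lim (\<lambda>n. F n z)"

lemma F_self_map: "analytic_self_map (F n)"
  unfolding F_def by (intro analytic_self_map_compose analytic_self_map_tau analytic_self_map_funpow self_map orbit)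

lemma F_ii: "F n \<i> = w 0"
  using funpow_orbit[of 0 n] by (simp add: F_def tau_ii)

lemma F_G:
  assumes "n \<le> m" shows "F m z = F n (G n m z)"
proof -
  have "(\<phi> ^^ m) (tau (w m) z) = (\<phi> ^^ n) ((\<phi> ^^ (m - n)) (tau (w m) z))"
    using assms by (simp flip: funpow_add comp_apply[of "\<phi> ^^ n"])
  then show ?thesis by (simp add: F_def G_def tau_tau_inv orbit)
qed

text \<open>Two errors are added in the Cayley coordinate: the deviation of \<open>G n m\<close>
  from the rotation by \<open>cayley (u n) / cayley (u m)\<close>, small by rigidity, and the
  deviation of this factor from 1, small because \<open>u\<close> converges.\<close>

lemma G_near_identity:
  assumes K: "compact K" "K \<subseteq> upper_halfplane" and e: "e > 0"
  shows "\<exists>N. \<forall>n\<ge>N. \<forall>m\<ge>n. \<forall>z\<in>K. pseudo_hyp_dist z (G n m z) < e"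
proof -
  obtain \<rho> where \<rho>: "0 < \<rho>" "\<rho> < 1" "\<And>z. z \<in> K \<Longrightarrow> pseudo_hyp_dist \<i> z \<le> \<rho>"
    using compact_dist_ii[OF K] by blast
  obtain \<delta> where \<delta>: "\<delta> > 0" "\<And>m z. z \<in> K \<Longrightarrow> \<delta> \<le> 1 - (pseudo_hyp_dist (u m) z)\<^sup>2"
    using dist_u_uniform[OF K] by blast
  \<comment> \<open>Two errors of size \<open>e'\<close> are divided by \<open>1 - \<rho>\<close> in
    \<open>dist_le_cayley_diff\<close>.\<close>
  define e' where "e' = e * (1 - \<rho>) / 2"
  have e': "e' > 0" using e \<rho> by (simp add: e'_def)
  have "(\<lambda>n. 1 - (d n / a)\<^sup>2) \<longlonglongrightarrow> 1 - (a / a)\<^sup>2"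
    using a_pos by (intro tendsto_intros d_lim) auto
  then have "\<forall>\<^sub>F n in sequentially. 1 - (d n / a)\<^sup>2 < e'\<^sup>2 * \<delta>"
    using a_pos e' \<delta> by (intro order_tendstoD(2)) auto
  then obtain N1 where N1: "\<And>n. n \<ge> N1 \<Longrightarrow> 1 - (d n / a)\<^sup>2 < e'\<^sup>2 * \<delta>"
    by (auto simp: eventually_sequentially)
  obtain N2 where N2: "\<And>n. n \<ge> N2 \<Longrightarrow> d n > a / 2"
    using order_tendstoD(1)[OF d_lim, of "a / 2"] a_pos by (auto simp: eventually_sequentially)
  have nz: "Complex b 1 + \<i> \<noteq> 0" by (simp add: complex_eq_iff)
  have "(\<lambda>n. cayley (u n)) \<longlonglongrightarrow> cayley (Complex b 1)"
    unfolding cayley_def using nz by (intro tendsto_intros u_lim)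
  then have "Cauchy (\<lambda>n. cayley (u n))" by (rule LIMSEQ_imp_Cauchy)
  then obtain N3 where N3: "\<And>m n. m \<ge> N3 \<Longrightarrow> n \<ge> N3 \<Longrightarrow> norm (cayley (u m) - cayley (u n)) < e' * (a / 2)"
    using CauchyD[of "\<lambda>n. cayley (u n)" "e' * (a / 2)"] e' a_pos by (metis half_gt_zero mult_pos_pos)
  have "pseudo_hyp_dist z (G n m z) < e" if n: "n \<ge> N1" "n \<ge> N2" "n \<ge> N3" and m: "m \<ge> n" and z: "z \<in> K" for n m z
  proof -
    have zH: "z \<in> upper_halfplane" using z K by auto
    have GH: "G n m z \<in> upper_halfplane" using analytic_self_map_in[OF G_self_map zH] .
    have dm: "d m > a / 2" using N2[OF n(2)] d_mono[OF m] by simp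
    have dpos: "d n > 0" "d m > 0" using N2[OF n(2)] dm a_pos by auto
    have "norm (cayley (G n m z) - cayley z) < 2 * e'"
    proof (cases "z = \<i>")
      case True
      then show ?thesis using G_ii[OF m] e' by simp
    next
      case False
      let ?l = "cayley (u n) / cayley (u m)"
      have cz: "cayley z \<noteq> 0" "norm (cayley z) \<le> 1"
        using False zH norm_cayley_less_1[OF zH] by (auto simp: cayley_eq_0_iff)
      have "(norm (cayley (G n m z) / cayley z - ?l))\<^sup>2 * \<delta>
          \<le> (norm (cayley (G n m z) / cayley z - ?l))\<^sup>2 * (1 - (pseudo_hyp_dist (u m) z)\<^sup>2)"
        using \<delta>(2)[OF z] by (intro mult_left_mono) auto
      also have "\<dots> \<le> 1 - (d n / d m)\<^sup>2"
        using G_rigid[OF m dpos(2) zH False] .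
      \<comment> \<open>Replacing \<open>d m\<close> by its upper bound \<open>a\<close> makes the
        estimate uniform in \<open>m\<close>.\<close>
      also have "\<dots> \<le> 1 - (d n / a)\<^sup>2"
        using dpos d_le_a[of m] a_pos by (intro diff_left_mono power_mono divide_left_mono) auto
      also have "\<dots> < e'\<^sup>2 * \<delta>" using N1[OF n(1)] .
      finally have "(norm (cayley (G n m z) / cayley z - ?l))\<^sup>2 < e'\<^sup>2" using \<delta>(1) by simp
      then have 1: "norm (cayley (G n m z) / cayley z - ?l) < e'"
        by (rule power2_less_imp_less) (use e' in simp)
      have "cayley (u m) \<noteq> 0" using dpos norm_cayley_u[of m] by auto
      then have "?l - 1 = (cayley (u n) - cayley (u m)) / cayley (u m)" by (simp add: diff_divide_distrib)
      then have "norm (?l - 1) = norm (cayley (u n) - cayley (u m)) / d m"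
        by (simp add: norm_divide norm_cayley_u)
      also have "\<dots> < e'"
      proof -
        have "norm (cayley (u n) - cayley (u m)) < e' * (a / 2)" using N3 n(3) m by simp
        also have "\<dots> < e' * d m" using dm e' by simp
        finally show ?thesis using dpos by (simp add: pos_divide_less_eq)
      qed
      finally have "norm (cayley (G n m z) / cayley z - 1) < 2 * e'"
        using 1 norm_triangle_ineq[of "cayley (G n m z) / cayley z - ?l" "?l - 1"] by simp
      moreover have "norm (cayley (G n m z) - cayley z) = norm (cayley (G n m z) / cayley z - 1) * norm (cayley z)"
        using cz by (simp add: divide_simps flip: norm_mult)
      moreover have "\<dots> \<le> norm (cayley (G n m z) / cayley z - 1)"
        using cz by (simp add: mult_left_le)
      ultimately show ?thesis by linarith
    qed
    then have "norm (cayley (G n m z) - cayley z) / (1 - \<rho>) < e"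
      using \<rho> by (simp add: e'_def pos_divide_less_eq)
    then show ?thesis using dist_le_cayley_diff[OF zH GH \<rho>(3)[OF z] \<rho>(2)] by simp
  qed
  then show ?thesis by (intro exI[of _ "max N1 (max N2 N3)"]) auto
qed

lemma F_dist_w0: "z \<in> upper_halfplane \<Longrightarrow> pseudo_hyp_dist (w 0) (F n z) \<le> pseudo_hyp_dist \<i> z"
  using Schwarz_Pick_halfplane[OF F_self_map ii_in, of z n] by (simp add: F_ii)

lemma F_in: "z \<in> upper_halfplane \<Longrightarrow> F n z \<in> upper_halfplane"
  using analytic_self_map_in[OF F_self_map] .

text \<open>The bound does not depend on \<open>n\<close>, so it passes to the limit and keeps
  \<open>\<psi> z\<close> off the real axis.\<close>

lemma Im_F_ge:
  assumes "z \<in> upper_halfplane"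
  shows "(1 - (pseudo_hyp_dist \<i> z)\<^sup>2) * Im (w 0) / 4 \<le> Im (F n z)"
proof -
  have "(pseudo_hyp_dist (w 0) (F n z))\<^sup>2 \<le> (pseudo_hyp_dist \<i> z)\<^sup>2"
    using F_dist_w0[OF assms] pseudo_hyp_dist_nonneg by (intro power_mono)
  then have "(1 - (pseudo_hyp_dist \<i> z)\<^sup>2) * Im (w 0) / 4
          \<le> (1 - (pseudo_hyp_dist (w 0) (F n z))\<^sup>2) * Im (w 0) / 4"
    using Im_w_pos[of 0] by (intro divide_right_mono mult_right_mono) auto
  also have "\<dots> \<le> Im (F n z)"
    using Im_ge_pseudo_hyp_dist orbit F_in assms by blast
  finally show ?thesis .
qed

text \<open>By \<open>F_G\<close> and Schwarz-Pick for \<open>F n\<close>, the points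
  \<open>F n z\<close> and \<open>F m z\<close> are no farther apart than \<open>z\<close> and
  \<open>G n m z\<close>. All \<open>F n\<close> send \<i> to \<open>w 0\<close>, so imaginary parts
  over \<open>K\<close> are bounded and Euclidean distances are small too.\<close>

lemma F_uniform_limit:
  assumes K: "compact K" "K \<subseteq> upper_halfplane"
  shows "uniform_limit K F \<psi> sequentially"
proof -
  obtain \<rho> where \<rho>: "0 < \<rho>" "\<rho> < 1" "\<And>z. z \<in> K \<Longrightarrow> pseudo_hyp_dist \<i> z \<le> \<rho>"
    using compact_dist_ii[OF K] by blast
  define R where "R = Im (w 0) + 2 * \<rho> * Im (w 0) / (1 - \<rho>)"
  have R: "R > 0" using Im_w_pos[of 0] \<rho> by (simp add: R_def add_pos_pos)
  have ImF: "Im (F n z) \<le> R" if z: "z \<in> K" for n z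
  proof -
    have zH: "z \<in> upper_halfplane" using z K by auto
    have "norm (F n z - w 0) \<le> 2 * \<rho> * Im (w 0) / (1 - \<rho>)"
      using F_dist_w0[OF zH, of n] \<rho>(3)[OF z] \<rho>(2)
      by (intro norm_diff_le_pseudo_hyp_dist orbit F_in zH) auto
    then show ?thesis using abs_Im_le_cmod[of "F n z - w 0"] by (simp add: R_def)
  qed
  have "uniformly_Cauchy_on K F"
  proof (rule uniformly_Cauchy_onI')
    fix e :: real assume e: "e > 0"
    \<comment> \<open>The value 1/2 keeps \<open>1 - e'\<close> at least 1/2, giving a Euclidean
      bound \<open>4 * R * e'\<close>; the factor 8 leaves room for strictness.\<close>
    define e' where "e' = min (1/2) (e / (8 * R))"
    have e': "e' > 0" "e' \<le> 1/2" "8 * R * e' \<le> e"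
      using e R by (auto simp: e'_def min_def field_simps)
    obtain N where N: "\<And>n m z. n \<ge> N \<Longrightarrow> m \<ge> n \<Longrightarrow> z \<in> K \<Longrightarrow> pseudo_hyp_dist z (G n m z) < e'"
      using G_near_identity[OF K e'(1)] by blast
    have "dist (F n z) (F m z) < e" if nm: "n \<ge> N" "m > n" and z: "z \<in> K" for n m z
    proof -
      have zH: "z \<in> upper_halfplane" using z K by auto
      have GH: "G n m z \<in> upper_halfplane" using analytic_self_map_in[OF G_self_map zH] .
      have "pseudo_hyp_dist (F n z) (F m z) \<le> pseudo_hyp_dist z (G n m z)"
        using Schwarz_Pick_halfplane[OF F_self_map zH GH] F_G[of n m z] nm by simp
      then have "pseudo_hyp_dist (F n z) (F m z) \<le> e'" using N[OF nm(1) _ z, of m] nm by simp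
      then have "norm (F m z - F n z) \<le> 2 * e' * Im (F n z) / (1 - e')"
        using e' by (intro norm_diff_le_pseudo_hyp_dist F_in zH) auto
      also have "\<dots> \<le> 2 * e' * R / (1/2)"
        using e' ImF[OF z] R F_in[OF zH, of n]
        by (intro frac_le mult_left_mono) (auto simp: upper_halfplane_def)
      also have "\<dots> < 8 * R * e'" using e' R by simp
      finally show ?thesis using e' by (simp add: dist_norm norm_minus_commute)
    qed
    then show "\<exists>M. \<forall>x\<in>K. \<forall>m\<ge>M. \<forall>n>m. dist (F m x) (F n x) < e" by blast
  qed
  then show ?thesis
    unfolding \<psi>_def using Cauchy_uniformly_convergent uniformly_convergent_uniform_limit_iff by blast
qed

lemma F_lim: "z \<in> upper_halfplane \<Longrightarrow> (\<lambda>n. F n z) \<longlonglongrightarrow> \<psi> z"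
  using tendsto_uniform_limitI[OF F_uniform_limit[of "{z}"]] by simp

section \<open>The limit map and its functional equation\<close>

lemma \<psi>_self_map: "analytic_self_map \<psi>"
  unfolding analytic_self_map_def
proof
  show "\<psi> holomorphic_on upper_halfplane"
  proof (rule holomorphic_uniform_sequence[OF open_upper_halfplane])
    show "F n holomorphic_on upper_halfplane" for n
      using F_self_map by (simp add: analytic_self_map_def)
    fix z assume "z \<in> upper_halfplane"
    then obtain e where "e > 0" "cball z e \<subseteq> upper_halfplane"
      using open_upper_halfplane open_contains_cball by blast
    then show "\<exists>e>0. cball z e \<subseteq> upper_halfplane \<and> uniform_limit (cball z e) F \<psi> sequentially"
      using F_uniform_limit compact_cball by blast
  qed
  have "Im (\<psi> z) > 0" if z: "z \<in> upper_halfplane" for z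
  proof -
    have "(pseudo_hyp_dist \<i> z)\<^sup>2 < 1"
      using pseudo_hyp_dist_less_1[OF ii_in z] pseudo_hyp_dist_nonneg[of \<i> z] by (simp add: abs_square_less_1)
    then have "0 < (1 - (pseudo_hyp_dist \<i> z)\<^sup>2) * Im (w 0) / 4"
      using Im_w_pos[of 0] by simp
    also have "\<dots> \<le> Im (\<psi> z)"
      using Im_F_ge[OF z] by (intro LIMSEQ_le_const[OF tendsto_Im[OF F_lim[OF z]]]) auto
    finally show ?thesis .
  qed
  then show "\<psi> ` upper_halfplane \<subseteq> upper_halfplane" by (auto simp: upper_halfplane_def)
qed

lemma G_Suc_lim:
  assumes z: "z \<in> upper_halfplane"
  shows "(\<lambda>n. G n (Suc n) z) \<longlonglongrightarrow> z"
proof (rule tendsto_of_pseudo_hyp_dist[OF z])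
  show "(\<lambda>n. pseudo_hyp_dist z (G n (Suc n) z)) \<longlonglongrightarrow> 0"
  proof (rule LIMSEQ_I)
    fix e :: real assume "e > 0"
    from G_near_identity[OF _ _ this, of "{z}"] z
    obtain N where "\<And>n m. n \<ge> N \<Longrightarrow> m \<ge> n \<Longrightarrow> pseudo_hyp_dist z (G n m z) < e" by auto
    then show "\<exists>N. \<forall>n\<ge>N. norm (pseudo_hyp_dist z (G n (Suc n) z) - 0) < e"
      using pseudo_hyp_dist_nonneg by (intro exI[of _ N]) auto
  qed
qed (use analytic_self_map_in[OF G_self_map z] in blast)

text \<open>\<open>\<phi> \<circ> F (Suc n) = F (Suc n) \<circ> \<beta> n\<close> for the self-map \<open>\<beta> n = (G n (Suc n) - s n) / r n\<close>,
  which tends to translation by \<open>-b\<close>.\<close>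
lemma functional_equation:
  assumes z: "z \<in> upper_halfplane"
  shows "\<psi> (z - of_real b) = \<phi> (\<psi> z)"
proof -
  define \<beta> where "\<beta> n = tau_inv (w (Suc n)) (tau (w n) (G n (Suc n) z))" for n
  have GH: "G n (Suc n) z \<in> upper_halfplane" for n using analytic_self_map_in[OF G_self_map z] .
  have \<beta>H: "\<beta> n \<in> upper_halfplane" for n
    unfolding \<beta>_def
    by (intro analytic_self_map_in[OF analytic_self_map_tau_inv] analytic_self_map_in[OF analytic_self_map_tau] orbit GH)
  have zb: "z - of_real b \<in> upper_halfplane" using z by (simp add: upper_halfplane_def)
  have eq: "\<phi> (F (Suc n) z) = F (Suc n) (\<beta> n)" for n
  proof -
    have "\<phi> (F (Suc n) z) = (\<phi> ^^ Suc n) (\<phi> (tau (w (Suc n)) z))"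
      by (simp add: F_def funpow_swap1)
    also have "\<phi> (tau (w (Suc n)) z) = tau (w n) (G n (Suc n) z)"
      by (simp add: G_def tau_tau_inv orbit)
    also have "\<dots> = tau (w (Suc n)) (\<beta> n)"
      by (simp add: \<beta>_def tau_tau_inv orbit)
    finally show ?thesis by (simp add: F_def)
  qed
  have "\<beta> n = (G n (Suc n) z - of_real (s n)) / of_real (r n)" for n
    using Im_w_pos[of n] Im_w_pos[of "Suc n"]
    by (simp add: \<beta>_def tau_inv_def tau_def s_def r_def field_simps)
  then have "\<beta> = (\<lambda>n. (G n (Suc n) z - of_real (s n)) / of_real (r n))" by blast
  moreover have "(\<lambda>n. (G n (Suc n) z - of_real (s n)) / of_real (r n)) \<longlonglongrightarrow> (z - of_real b) / of_real 1"
    by (intro tendsto_intros G_Suc_lim z s_lim r_lim) simp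
  ultimately have "\<beta> \<longlonglongrightarrow> z - of_real b" by simp
  then have dist: "(\<lambda>n. pseudo_hyp_dist (\<beta> n) (z - of_real b)) \<longlonglongrightarrow> 0"
    using pseudo_hyp_dist_tendsto_0 zb by blast
  have \<psi>z: "\<psi> z \<in> upper_halfplane" using analytic_self_map_in[OF \<psi>_self_map z] .
  have "continuous_on upper_halfplane \<phi>"
    using self_map holomorphic_on_imp_continuous_on by (auto simp: analytic_self_map_def)
  then have "isCont \<phi> (\<psi> z)"
    using open_upper_halfplane \<psi>z continuous_on_eq_continuous_at by blast
  then have 1: "(\<lambda>n. F (Suc n) (\<beta> n)) \<longlonglongrightarrow> \<phi> (\<psi> z)"
    using isCont_tendsto_compose[OF _ LIMSEQ_Suc[OF F_lim[OF z]]] by (simp flip: eq)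
  \<comment> \<open>Schwarz-Pick makes the \<open>F (Suc n)\<close> equicontinuous, so the moving
    argument \<open>\<beta> n\<close> may be replaced by its limit.\<close>
  have "(\<lambda>n. pseudo_hyp_dist (F (Suc n) (\<beta> n)) (F (Suc n) (z - of_real b))) \<longlonglongrightarrow> 0"
    by (rule tendsto_sandwich[OF _ _ tendsto_const dist])
       (auto intro!: always_eventually pseudo_hyp_dist_nonneg Schwarz_Pick_halfplane F_self_map \<beta>H zb)
  moreover have "(\<lambda>n. pseudo_hyp_dist (F (Suc n) (\<beta> n)) (F (Suc n) (z - of_real b)))
      \<longlonglongrightarrow> pseudo_hyp_dist (\<phi> (\<psi> z)) (\<psi> (z - of_real b))"
    unfolding pseudo_hyp_dist_def
    using upper_halfplane_minus_cnj_nonzero[OF analytic_self_map_in[OF self_map \<psi>z] analytic_self_map_in[OF \<psi>_self_map zb]]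
    by (intro tendsto_intros 1 LIMSEQ_Suc[OF F_lim[OF zb]])
  ultimately have "pseudo_hyp_dist (\<phi> (\<psi> z)) (\<psi> (z - of_real b)) = 0"
    using LIMSEQ_unique by blast
  then show ?thesis
    using upper_halfplane_minus_cnj_nonzero[OF analytic_self_map_in[OF self_map \<psi>z] analytic_self_map_in[OF \<psi>_self_map zb]]
    by (simp add: pseudo_hyp_dist_def)
qed

end

theorem theorem1p12:
  fixes \<phi> :: "complex \<Rightarrow> complex" and w :: "nat \<Rightarrow> complex" and a b0 :: real
  defines "b0 \<equiv> 2 * a / sqrt (1 - a\<^sup>2)"
  assumes "parabolic_self_map \<phi>"
    and "backward_iteration_sequence \<phi> w"
    and "incseq (\<lambda>n. pseudo_hyp_dist (w n) (w (Suc n)))"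
    and "(\<lambda>n. pseudo_hyp_dist (w n) (w (Suc n))) \<longlonglongrightarrow> a"
    and "a < 1"
    and "filterlim w at_infinity sequentially"
    and "(\<lambda>n. Arg (w n)) \<longlonglongrightarrow> 0"
  shows "(\<exists>\<psi>. analytic_self_map \<psi> \<and>
            (\<forall>K. compact K \<and> K \<subseteq> upper_halfplane \<longrightarrow>
               uniform_limit K (\<lambda>n. (\<phi> ^^ n) \<circ> tau (w n)) \<psi> sequentially) \<and>
            (\<forall>z\<in>upper_halfplane. \<psi> (z - of_real b0) = \<phi> (\<psi> z))) \<and>
         (\<lambda>n. (Re (w (Suc n)) - Re (w n)) / Im (w n)) \<longlonglongrightarrow> b0"
proof -
  \<comment> \<open>Parabolicity supplies \<open>Im_increasing\<close> through Julia's
    lemma.\<close>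
  interpret backward_orbit \<phi> w a
    using assms Im_le_Im_parabolic
    by unfold_locales (auto simp: parabolic_self_map_def backward_iteration_sequence_def)
  have "b0 = b" by (simp add: b0_def b_def)
  then show ?thesis
    using \<psi>_self_map F_uniform_limit functional_equation s_lim
    unfolding F_def[abs_def] s_def[abs_def] by blast
qed

end
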